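(* Assume $L$ satisfies Assumption (A), and let $u\in H^{s/2}$. Let $\varphi,\psi\in C^\infty(\mathbb R)$ satisfy $0\le\varphi,\psi\le1$, with - $\varphi(x)=1$ for $|x|<1$ and $\varphi(x)=0$ for $|x|>2$, - $\psi(x)=0$ for $|x|<1$ and $\psi(x)=1$ for $|x|>2$. Set $\varphi_r(x)=\varphi(x/r)$ and $\psi_r(x)=\psi(x/r)$. Then $$\int_{\mathbb R}\varphi_ru\big(L(\varphi_ru)-\varphi_rLu\big)\,dx\to0 \quad\text{and}\quad \int_{\mathbb R}\psi_ru\big(L(\psi_ru)-\psi_rLu\big)\,dx\to0$$ as $r\to\infty$.
   Context: Fourier transform: $\hat u(\xi)=\int e^{-2\pi ix\xi}u(x)\,dx$. Assumption (A): $s>0$ and $L$ is the Fourier multiplier $\widehat{Lu}=m\hat u$. The symbol $m:\mathbb R\to\mathbb R$ is piecewise continuous with finitely many discontinuities, and there are constants $A_1,A_2>0$ with $A_1|\xi|^s\le m(\xi)\le A_2|\xi|^s$ for $|\xi|\ge1$ and $0\le m(\xi)\le A_2$ for $|\xi|\le1$. For $u,v\in H^{s/2}$ the pairing $\int vLu$ is understood as $\int \overline{\hat v}\,m\,\hat u\,d\xi$ (duality between $H^{s/2}$ and $H^{-s/2}$). *)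

theory Defs
  imports "HOL-Analysis.Analysis"
begin

definition trunc_fourier :: "(real \<Rightarrow> complex) \<Rightarrow> nat \<Rightarrow> real \<Rightarrow> complex" where
  "trunc_fourier u n \<xi> =
     (LINT x:{- real n..real n}|lborel. exp (- (2 * complex_of_real pi * \<i> * complex_of_real x * complex_of_real \<xi>)) * u x)"

definition L2 :: "(real \<Rightarrow> complex) \<Rightarrow> bool" where
  "L2 u \<longleftrightarrow> u \<in> borel_measurable lborel \<and> integrable lborel (\<lambda>x. (cmod (u x))\<^sup>2)"

text \<open>U is (a representative of) the Plancherel Fourier transform of u:
  the L^2 limit of the truncated Fourier integrals.\<close>
definition fourier_L2 :: "(real \<Rightarrow> complex) \<Rightarrow> (real \<Rightarrow> complex) \<Rightarrow> bool" where
  "fourier_L2 u U \<longleftrightarrow> L2 u \<and> L2 U \<and>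
     (\<lambda>n. \<integral>\<^sup>+ \<xi>. ennreal ((cmod (trunc_fourier u n \<xi> - U \<xi>))\<^sup>2) \<partial>lborel) \<longlonglongrightarrow> 0"

definition sobolev :: "real \<Rightarrow> (real \<Rightarrow> complex) \<Rightarrow> bool" where
  "sobolev \<sigma> u \<longleftrightarrow> L2 u \<and>
     (\<exists>U. fourier_L2 u U \<and> integrable lborel (\<lambda>\<xi>. (1 + \<xi>\<^sup>2) powr \<sigma> * (cmod (U \<xi>))\<^sup>2))"

definition fourier :: "(real \<Rightarrow> complex) \<Rightarrow> real \<Rightarrow> complex" where
  "fourier u = (SOME U. fourier_L2 u U)"

text \<open>The pairing  int v L w := int conj(v^) m w^ dxi  (duality H^{s/2} x H^{-s/2}).\<close>
definition pairing :: "(real \<Rightarrow> real) \<Rightarrow> (real \<Rightarrow> complex) \<Rightarrow> (real \<Rightarrow> complex) \<Rightarrow> complex" where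
  "pairing m v w = (LINT \<xi>|lborel. cnj (fourier v \<xi>) * complex_of_real (m \<xi>) * fourier w \<xi>)"

definition piecewise_cont :: "(real \<Rightarrow> real) \<Rightarrow> bool" where
  "piecewise_cont m \<longleftrightarrow> (\<exists>D. finite D \<and> (\<forall>x. x \<notin> D \<longrightarrow> isCont m x) \<and>
     (\<forall>x\<in>D. (\<exists>l. (m \<longlongrightarrow> l) (at_left x)) \<and> (\<exists>l. (m \<longlongrightarrow> l) (at_right x))))"

definition assumptionA :: "real \<Rightarrow> (real \<Rightarrow> real) \<Rightarrow> bool" where
  "assumptionA s m \<longleftrightarrow> s > 0 \<and> piecewise_cont m \<and>
     (\<exists>A1 A2. A1 > 0 \<and> A2 > 0 \<and>
        (\<forall>\<xi>. \<bar>\<xi>\<bar> \<ge> 1 \<longrightarrow> A1 * \<bar>\<xi>\<bar> powr s \<le> m \<xi> \<and> m \<xi> \<le> A2 * \<bar>\<xi>\<bar> powr s) \<and>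
        (\<forall>\<xi>. \<bar>\<xi>\<bar> \<le> 1 \<longrightarrow> 0 \<le> m \<xi> \<and> m \<xi> \<le> A2))"

definition smooth :: "(real \<Rightarrow> real) \<Rightarrow> bool" where
  "smooth f \<longleftrightarrow> (\<forall>k x. ((deriv ^^ k) f) differentiable (at x))"

end

theory Submission
  imports Defs "HOL-Probability.Characteristic_Functions" "HOL-Probability.Sinc_Integral"
begin

text \<open>
  If \<open>f\<close> is smooth and constant outside a bounded set, then \<open>f (x / r) u(x)\<close> converges to \<open>f 0 u\<close> in the
  Sobolev space of exponent \<open>s / 2\<close> as \<open>r\<close> tends to infinity. Since the symbol \<open>m\<close> is bounded by a multiple of
  the Sobolev weight, the pairing is continuous there, and both terms of the difference converge to
  the same limit, \<open>(f 0)\<^sup>2\<close> times the pairing of \<open>u\<close> with itself; no commutator estimate is needed.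

  For the convergence we may subtract the constant and write \<open>f\<close> as the inverse Fourier transform of a rapidly
  decreasing \<open>K\<close>. The Fourier transform of \<open>f (x / r) u(x)\<close> is then the average of the translates
  \<open>U (\<xi> - \<eta> / r)\<close> against \<open>K \<eta>\<close>, where \<open>U\<close> is the transform of \<open>u\<close>. Translation is continuous in the
  weighted \<open>L\<^sup>2\<close> space, so dominated convergence applies. The same formula
  provides the Fourier transforms of the products, so Plancherel's theorem is never used.
\<close>

text \<open>A cutoff equal to 1 near infinity is not the inverse transform of an integrable
  function, so it is \<open>c - f\<close>, with \<open>c\<close> the value of \<open>f\<close> at
  infinity, that is represented by a kernel \<open>K\<close>. As the dilation parameter
  \<open>h\<close> (that is, \<open>1 / r\<close>) tends to 0, only the total mass of
  \<open>K\<close> survives on the Fourier side; inversion at the origin evaluates this mass as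
  \<open>c - f 0\<close>, and this is the origin of the factor \<open>f 0\<close> in the limit. A
  shift by \<open>h * \<eta>\<close> costs a power of \<eta> in the weighted norm, so dominated
  convergence in \<eta> asks for \<open>K\<close> to be integrable against the Sobolev weight.
  Smoothness of \<open>f\<close> provides this for every exponent. The function
  \<open>fourier\<close> is a choice among representatives: nothing is known about it before some
  transform has been exhibited, and afterwards only up to null sets. Hence convergence is measured
  by energies and never pointwise in the frequency.\<close>

section \<open>Null sequences of extended nonnegative reals and elementary inequalities\<close>

text \<open>Replaces a limes superior in density arguments: the null sequence \<open>Y\<close> may
  depend on the error \<open>e\<close>.\<close>

lemma ennreal_tendsto_0_if_approx:
  fixes X :: "nat \<Rightarrow> ennreal"
  assumes "\<And>e::real. e > 0 \<Longrightarrow> \<exists>Y. Y \<longlonglongrightarrow> 0 \<and> (\<forall>n. X n \<le> Y n + ennreal e)"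
  shows "X \<longlonglongrightarrow> 0"
proof (rule order_tendstoI)
  fix a :: ennreal assume "0 < a"
  then obtain b where b: "0 < b" "b < a" using dense by blast
  then obtain e' where e': "b = ennreal e'" "e' > 0"
    by (cases b) (auto simp: top_unique)
  obtain Y where Y: "Y \<longlonglongrightarrow> 0" "\<And>n. X n \<le> Y n + ennreal (e'/2)"
    using assms[of "e'/2"] e' by auto
  have "eventually (\<lambda>n. Y n < ennreal (e'/2)) sequentially"
    using Y(1) e' by (intro order_tendstoD) auto
  then show "eventually (\<lambda>n. X n < a) sequentially"
  proof eventually_elim
    case (elim n)
    have "X n \<le> Y n + ennreal (e'/2)" by (rule Y)
    also have "\<dots> \<le> ennreal (e'/2) + ennreal (e'/2)" using elim by (intro add_right_mono) auto
    also have "\<dots> = b" using e' by (simp flip: ennreal_plus)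
    finally show ?case using b by simp
  qed
qed auto

lemma ennreal_tendsto_0_le:
  fixes X Y :: "'b \<Rightarrow> ennreal"
  assumes "(Y \<longlongrightarrow> 0) F" "\<And>n. X n \<le> Y n"
  shows "(X \<longlongrightarrow> 0) F"
  using assms by (intro tendsto_sandwich[of "\<lambda>_. 0" X F Y 0]) auto

lemma ennreal_tendsto_0_cmult:
  fixes X :: "'b \<Rightarrow> ennreal"
  assumes "(X \<longlongrightarrow> 0) F" "c < \<infinity>"
  shows "((\<lambda>n. c * X n) \<longlongrightarrow> 0) F"
  using ennreal_tendsto_cmult[of c X 0 F] assms by simp

lemma ennreal_tendsto_0_add:
  fixes X Y :: "'b \<Rightarrow> ennreal"
  assumes "(X \<longlongrightarrow> 0) F" "(Y \<longlongrightarrow> 0) F"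
  shows "((\<lambda>n. X n + Y n) \<longlongrightarrow> 0) F"
  using tendsto_add[OF assms] by simp

lemma nn_integral_lborel_shift:
  fixes h :: real and f :: "real \<Rightarrow> ennreal"
  assumes "f \<in> borel_measurable borel"
  shows "(\<integral>\<^sup>+x. f (x - h) \<partial>lborel) = (\<integral>\<^sup>+x. f x \<partial>lborel)"
  using nn_integral_real_affine[OF assms, of 1 "-h"] by simp

lemma norm_add_sq_le:
  fixes a b :: "'a :: real_normed_vector"
  shows "(norm (a + b))\<^sup>2 \<le> 2 * (norm a)\<^sup>2 + 2 * (norm b)\<^sup>2"
proof -
  have "(norm (a + b))\<^sup>2 \<le> (norm a + norm b)\<^sup>2"
    by (intro power_mono norm_triangle_ineq) auto
  also have "\<dots> \<le> 2 * (norm a)\<^sup>2 + 2 * (norm b)\<^sup>2"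
    using zero_le_power2[of "norm a - norm b"] by (simp add: power2_eq_square algebra_simps)
  finally show ?thesis .
qed

section \<open>Continuity of translation\<close>

text \<open>A point of an open set stays in it under small shifts, so the integrand is eventually 0
  at every point, with \<open>indicator S\<close> as dominating function. Only this half of the
  symmetric difference of \<open>S\<close> and its translate has such a pointwise argument; the
  other half reduces to it by a change of variables.\<close>

lemma translation_continuous_open:
  fixes h :: "nat \<Rightarrow> real"
  assumes "open S" and fin: "emeasure lborel S < \<infinity>" and h: "h \<longlonglongrightarrow> 0"
  shows "(\<lambda>n. \<integral>\<^sup>+x. indicator S x * indicator (-S) (x - h n) \<partial>lborel) \<longlonglongrightarrow> 0"
proof -
  have [measurable]: "S \<in> sets borel" using assms by auto
  have "(\<lambda>n. \<integral>\<^sup>+x. indicator S x * indicator (-S) (x - h n) \<partial>lborel) \<longlonglongrightarrow> (\<integral>\<^sup>+x. (0::ennreal) \<partial>(lborel::real measure))"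
  proof (rule nn_integral_dominated_convergence[where w="indicator S"])
    show "AE x in lborel. (\<lambda>i. indicator S x * indicator (- S) (x - h i) :: ennreal) \<longlonglongrightarrow> 0"
    proof (rule AE_I2)
      fix x
      show "(\<lambda>i. indicator S x * indicator (- S) (x - h i) :: ennreal) \<longlonglongrightarrow> 0"
      proof (cases "x \<in> S")
        case True
        have "(\<lambda>i. x - h i) \<longlonglongrightarrow> x" using tendsto_diff[OF tendsto_const h, of x] by simp
        then have "eventually (\<lambda>i. x - h i \<in> S) sequentially"
          using True \<open>open S\<close> by (auto dest: topological_tendstoD)
        then show ?thesis
          by (intro tendsto_eventually, eventually_elim) auto
      qed simp
    qed
    show "\<And>j. AE x in lborel. indicator S x * indicator (- S) (x - h j) \<le> (indicator S x :: ennreal)"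
      by (auto split: split_indicator)
  qed (use fin in auto)
  then show ?thesis by simp
qed

text \<open>The property survives limits in the mean, because translation preserves the integral. It
  therefore spreads from indicators of open sets to indicators of measurable sets by outer
  regularity, and then to all integrable functions by induction; continuous functions never
  enter.\<close>

theorem translation_continuous_L1:
  fixes f :: "real \<Rightarrow> 'a :: {banach, second_countable_topology}"
  assumes "integrable lborel f" and h: "h \<longlonglongrightarrow> 0"
  shows "(\<lambda>n. \<integral>\<^sup>+x. ennreal (norm (f (x - h n) - f x)) \<partial>lborel) \<longlonglongrightarrow> 0"
proof -
  \<comment> \<open>Closure under approximation: \<open>f\<close> and its translate are each within
    \<open>e / 2\<close> of \<open>g\<close> and its translate.\<close>
  have approx: "(\<lambda>n. \<integral>\<^sup>+x. ennreal (norm (f (x - h n) - f x)) \<partial>lborel) \<longlonglongrightarrow> 0"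
    if f: "f \<in> borel_measurable borel"
      and g: "\<And>e::real. e > 0 \<Longrightarrow> \<exists>g. g \<in> borel_measurable borel \<and> (\<integral>\<^sup>+x. ennreal (norm (f x - g x)) \<partial>lborel) \<le> ennreal e
        \<and> (\<lambda>n. \<integral>\<^sup>+x. ennreal (norm (g (x - h n) - g x)) \<partial>lborel) \<longlonglongrightarrow> 0"
    for f :: "real \<Rightarrow> 'a"
  proof (rule ennreal_tendsto_0_if_approx)
    note [measurable] = f
    fix e :: real assume e: "e > 0"
    obtain g where g_m[measurable]: "g \<in> borel_measurable borel"
      and ge: "(\<integral>\<^sup>+x. ennreal (norm (f x - g x)) \<partial>lborel) \<le> ennreal (e/2)"
      and gl: "(\<lambda>n. \<integral>\<^sup>+x. ennreal (norm (g (x - h n) - g x)) \<partial>lborel) \<longlonglongrightarrow> 0"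
      using g[of "e/2"] e by auto
    have "(\<integral>\<^sup>+x. ennreal (norm (f (x - k) - f x)) \<partial>lborel)
        \<le> (\<integral>\<^sup>+x. ennreal (norm (g (x - k) - g x)) \<partial>lborel) + ennreal e" for k
    proof -
      have "(\<integral>\<^sup>+x. ennreal (norm (f (x - k) - f x)) \<partial>lborel)
        \<le> (\<integral>\<^sup>+x. ennreal (norm (g (x - k) - g x)) + (ennreal (norm (f (x-k) - g (x-k))) + ennreal (norm (f x - g x))) \<partial>lborel)"
      proof (intro nn_integral_mono)
        fix x
        have "norm (f (x - k) - f x) = norm ((g (x - k) - g x) + ((f (x-k) - g (x-k)) - (f x - g x)))"
          by (simp add: algebra_simps)
        also have "\<dots> \<le> norm (g (x - k) - g x) + (norm (f (x-k) - g (x-k)) + norm (f x - g x))"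
          by (intro order_trans[OF norm_triangle_ineq] add_left_mono norm_triangle_ineq4)
        finally show "ennreal (norm (f (x - k) - f x)) \<le> ennreal (norm (g (x - k) - g x)) + (ennreal (norm (f (x-k) - g (x-k))) + ennreal (norm (f x - g x)))"
          by (simp flip: ennreal_plus)
      qed
      also have "\<dots> = (\<integral>\<^sup>+x. ennreal (norm (g (x - k) - g x)) \<partial>lborel)
          + ((\<integral>\<^sup>+x. ennreal (norm (f (x-k) - g (x-k))) \<partial>lborel) + (\<integral>\<^sup>+x. ennreal (norm (f x - g x)) \<partial>lborel))"
        by (simp add: nn_integral_add)
      also have "(\<integral>\<^sup>+x. ennreal (norm (f (x-k) - g (x-k))) \<partial>lborel) = (\<integral>\<^sup>+x. ennreal (norm (f x - g x)) \<partial>lborel)"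
        by (rule nn_integral_lborel_shift[where f="\<lambda>x. ennreal (norm (f x - g x))"]) simp
      also have "(\<integral>\<^sup>+x. ennreal (norm (f x - g x)) \<partial>lborel) + (\<integral>\<^sup>+x. ennreal (norm (f x - g x)) \<partial>lborel) \<le> ennreal (e/2) + ennreal (e/2)"
        by (intro add_mono ge)
      also have "ennreal (e/2) + ennreal (e/2) = ennreal e" using e by (simp flip: ennreal_plus)
      finally show ?thesis by (simp add: add_left_mono)
    qed
    with gl show "\<exists>Y. Y \<longlonglongrightarrow> 0 \<and> (\<forall>n. (\<integral>\<^sup>+x. ennreal (norm (f (x - h n) - f x)) \<partial>lborel) \<le> Y n + ennreal e)"
      by blast
  qed
  show ?thesis
    using assms(1)
  proof (induction rule: integrable_induct)
    case (base A c)
    then have [measurable]: "A \<in> sets borel" by simp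
    show ?case
    proof (rule approx)
      fix e :: real assume e: "e > 0"
      \<comment> \<open>The summand 1 keeps the quotient meaningful when \<open>c\<close> is
        0.\<close>
      define e' where "e' = e / (norm c + 1)"
      have e': "e' > 0" "e' * norm c \<le> e"
        using e by (auto simp: e'_def field_simps add_pos_nonneg add_nonneg_pos)
      obtain S where S: "open S" "A \<subseteq> S" "emeasure lborel (S - A) \<le> e'"
        using outer_regular_lborel_le[of A e'] e' by auto
      have [measurable]: "S \<in> sets borel" using S by auto
      have "emeasure lborel S \<le> emeasure lborel A + emeasure lborel (S - A)"
        using S(2) by (subst plus_emeasure) (auto simp: Un_absorb1)
      also have "\<dots> < \<infinity>" using base S(3)
        by (metis ennreal_add_less_top ennreal_less_top infinity_ennreal_def le_less_trans)
      finally have fin: "emeasure lborel S < \<infinity>" .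
      \<comment> \<open>The part of the symmetric difference lying in the translate of
        \<open>S\<close> is moved back by \<open>k\<close>, which turns it into the half already
        treated, with the shift reversed.\<close>
      have split: "(\<integral>\<^sup>+x. ennreal (norm (indicator S (x - k) *\<^sub>R c - indicator S x *\<^sub>R c)) \<partial>lborel)
          = norm c * ((\<integral>\<^sup>+x. indicator S x * indicator (-S) (x - k) \<partial>lborel) + (\<integral>\<^sup>+x. indicator S x * indicator (-S) (x + k) \<partial>lborel))" for k
      proof -
        have "(\<integral>\<^sup>+x. ennreal (norm (indicator S (x - k) *\<^sub>R c - indicator S x *\<^sub>R c)) \<partial>lborel)
          = (\<integral>\<^sup>+x. ennreal (norm c) * (indicator S x * indicator (-S) (x - k) + indicator S (x-k) * indicator (-S) ((x-k)+k)) \<partial>lborel)"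
          by (intro nn_integral_cong) (auto split: split_indicator)
        also have "\<dots> = norm c * ((\<integral>\<^sup>+x. indicator S x * indicator (-S) (x - k) \<partial>lborel) + (\<integral>\<^sup>+x. indicator S (x-k) * indicator (-S) ((x-k)+k) \<partial>lborel))"
          by (subst nn_integral_cmult, simp, subst nn_integral_add) auto
        also have "(\<integral>\<^sup>+x. indicator S (x-k) * indicator (-S) ((x-k)+k) \<partial>lborel) = (\<integral>\<^sup>+x. indicator S x * indicator (-S) (x+k) \<partial>lborel)"
          by (rule nn_integral_lborel_shift[where f="\<lambda>x. indicator S x * indicator (-S) (x+k)"]) simp
        finally show ?thesis .
      qed
      have "(\<lambda>n. \<integral>\<^sup>+x. ennreal (norm (indicator S (x - h n) *\<^sub>R c - indicator S x *\<^sub>R c)) \<partial>lborel) \<longlonglongrightarrow> 0"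
        unfolding split
        using translation_continuous_open[OF S(1) fin h] translation_continuous_open[OF S(1) fin, of "\<lambda>n. - h n"]
          tendsto_minus[OF h]
        by (intro ennreal_tendsto_0_cmult ennreal_tendsto_0_add) auto
      moreover have "(\<integral>\<^sup>+x. ennreal (norm (indicator A x *\<^sub>R c - indicator S x *\<^sub>R c)) \<partial>lborel) \<le> ennreal e"
      proof -
        have "(\<integral>\<^sup>+x. ennreal (norm (indicator A x *\<^sub>R c - indicator S x *\<^sub>R c)) \<partial>lborel) = (\<integral>\<^sup>+x. ennreal (norm c) * indicator (S - A) x \<partial>lborel)"
          using S(2) by (intro nn_integral_cong) (auto split: split_indicator)
        also have "\<dots> = norm c * emeasure lborel (S - A)"
          by (subst nn_integral_cmult) auto
        also have "\<dots> \<le> norm c * ennreal e'" by (intro mult_left_mono S) auto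
        also have "\<dots> \<le> ennreal e" using e' e by (simp add: mult.commute ennreal_leI flip: ennreal_mult)
        finally show ?thesis .
      qed
      ultimately show "\<exists>g. g \<in> borel_measurable borel \<and> (\<integral>\<^sup>+x. ennreal (norm (indicator A x *\<^sub>R c - g x)) \<partial>lborel) \<le> ennreal e
        \<and> (\<lambda>n. \<integral>\<^sup>+x. ennreal (norm (g (x - h n) - g x)) \<partial>lborel) \<longlonglongrightarrow> 0"
        by (intro exI[of _ "\<lambda>x. indicator S x *\<^sub>R c"] conjI) auto
    qed simp
  next
    case (add f g)
    then have [measurable]: "f \<in> borel_measurable borel" "g \<in> borel_measurable borel"
      using borel_measurable_integrable[of lborel f] borel_measurable_integrable[of lborel g] by auto
    show ?case
    proof (rule ennreal_tendsto_0_le[OF ennreal_tendsto_0_add[OF add.IH]])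
      fix n
      have "(\<integral>\<^sup>+x. ennreal (norm (f (x - h n) + g (x - h n) - (f x + g x))) \<partial>lborel)
        \<le> (\<integral>\<^sup>+x. ennreal (norm (f (x - h n) - f x)) + ennreal (norm (g (x - h n) - g x)) \<partial>lborel)"
      proof (intro nn_integral_mono)
        fix x
        show "ennreal (norm (f (x - h n) + g (x - h n) - (f x + g x))) \<le> ennreal (norm (f (x - h n) - f x)) + ennreal (norm (g (x - h n) - g x))"
          using norm_triangle_ineq[of "f (x - h n) - f x" "g (x - h n) - g x"]
          by (simp add: algebra_simps flip: ennreal_plus)
      qed
      then show "(\<integral>\<^sup>+x. ennreal (norm (f (x - h n) + g (x - h n) - (f x + g x))) \<partial>lborel)
        \<le> (\<integral>\<^sup>+x. ennreal (norm (f (x - h n) - f x)) \<partial>lborel) + (\<integral>\<^sup>+x. ennreal (norm (g (x - h n) - g x)) \<partial>lborel)"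
        by (simp add: nn_integral_add)
    qed
  next
    case (lim f s)
    have [measurable]: "f \<in> borel_measurable borel" "\<And>i. s i \<in> borel_measurable borel"
      using borel_measurable_integrable[OF lim.hyps(4)] borel_measurable_integrable[OF lim.hyps(1)] by auto
    show ?case
    proof (rule approx)
      fix e :: real assume "e > 0"
      have "(\<lambda>i. (\<integral>\<^sup>+x. norm (f x - s i x) \<partial>lborel)) \<longlonglongrightarrow> 0"
        using lim.hyps(2,3,4)
        by (intro nn_integral_dominated_convergence_norm[where w="\<lambda>x. 2 * norm (f x)"])
           (auto simp: integrable_iff_bounded nn_integral_cmult ennreal_mult ennreal_mult_less_top)
      then have "eventually (\<lambda>i. (\<integral>\<^sup>+x. norm (f x - s i x) \<partial>lborel) < ennreal e) sequentially"
        using \<open>e > 0\<close> by (intro order_tendstoD) auto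
      then obtain i where "(\<integral>\<^sup>+x. norm (f x - s i x) \<partial>lborel) < ennreal e"
        by (auto dest: eventually_happens)
      then show "\<exists>g. g \<in> borel_measurable borel \<and> (\<integral>\<^sup>+x. ennreal (norm (f x - g x)) \<partial>lborel) \<le> ennreal e
        \<and> (\<lambda>n. \<integral>\<^sup>+x. ennreal (norm (g (x - h n) - g x)) \<partial>lborel) \<longlonglongrightarrow> 0"
        using lim.IH by (intro exI[of _ "s i"]) auto
    qed simp
  qed
qed

text \<open>Reduces continuity of translation in \<open>L\<^sup>2\<close> to the case of \<open>L\<^sup>1\<close>, by passing from \<open>U\<close> to \<open>\<bar>U\<bar> U\<close>.\<close>

lemma norm_diff_sq_le_norm_scaled_diff:
  fixes a b :: "'a :: real_inner"
  shows "(norm (a - b))\<^sup>2 \<le> 2 * norm (norm a *\<^sub>R a - norm b *\<^sub>R b)"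
proof (cases "a = b")
  case False
  define p q t where "p = norm a" and "q = norm b" and "t = inner a b"
  have pp: "inner a a = p\<^sup>2" "inner b b = q\<^sup>2" by (simp_all add: p_def q_def power2_norm_eq_inner)
  have d: "(norm (a - b))\<^sup>2 = p\<^sup>2 + q\<^sup>2 - 2 * t"
    by (simp add: power2_norm_eq_inner inner_diff inner_commute pp t_def)
  have i: "inner (p *\<^sub>R a - q *\<^sub>R b) (a - b) = p^3 + q^3 - (p + q) * t"
    by (simp add: inner_diff inner_commute pp flip: t_def) (simp add: power2_eq_square power3_eq_cube algebra_simps)
  have nn: "p \<ge> 0" "q \<ge> 0" by (auto simp: p_def q_def)
  \<comment> \<open>This is exactly the difference of the two sides of the next inequality; the
    terms containing \<open>t\<close> cancel.\<close>
  have "(p + q) * (p - q)\<^sup>2 \<ge> 0" using nn by simp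
  then have "(p + q) * (norm (a - b))\<^sup>2 \<le> 2 * inner (p *\<^sub>R a - q *\<^sub>R b) (a - b)"
    unfolding d i by (simp add: power2_eq_square power3_eq_cube algebra_simps)
  also have "\<dots> \<le> 2 * (norm (p *\<^sub>R a - q *\<^sub>R b) * norm (a - b))"
    using norm_cauchy_schwarz by (intro mult_left_mono) auto
  finally have "((p + q) * norm (a - b)) * norm (a - b) \<le> (2 * norm (p *\<^sub>R a - q *\<^sub>R b)) * norm (a - b)"
    by (simp add: power2_eq_square mult.assoc)
  then have "(p + q) * norm (a - b) \<le> 2 * norm (p *\<^sub>R a - q *\<^sub>R b)"
    using False by (subst (asm) mult_le_cancel_right_pos) auto
  moreover have "norm (a - b) * norm (a - b) \<le> (p + q) * norm (a - b)"
    unfolding p_def q_def by (intro mult_right_mono norm_triangle_ineq4) auto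
  ultimately show ?thesis by (simp add: p_def q_def power2_eq_square)
qed simp

section \<open>The Sobolev weight and the weighted energy\<close>

text \<open>The halved exponent matches the integrand of \<open>sobolev (s / 2)\<close>, so the
  weight grows like the power \<open>s\<close> of the frequency, which is the order of the
  symbol.\<close>

definition weight :: "real \<Rightarrow> real \<Rightarrow> real" where
  "weight s \<xi> = (1 + \<xi>\<^sup>2) powr (s / 2)"

lemma weight_measurable [measurable]: "weight s \<in> borel_measurable borel"
  unfolding weight_def by measurable

lemma weight_pos: "weight s \<xi> > 0"
proof -
  have "1 + \<xi>\<^sup>2 > 0" by (simp add: add_pos_nonneg)
  then show ?thesis unfolding weight_def by simp
qed

lemma weight_nonneg [simp]: "weight s \<xi> \<ge> 0"
  using weight_pos[of s \<xi>] by simp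

lemma weight_ge_1: "s \<ge> 0 \<Longrightarrow> weight s \<xi> \<ge> 1"
  unfolding weight_def by (intro ge_one_powr_ge_zero) auto

lemma continuous_weight: "isCont (weight s) x"
proof -
  have "1 + x\<^sup>2 \<noteq> 0" by (metis add_pos_nonneg less_irrefl zero_le_power2 zero_less_one)
  then show ?thesis unfolding weight_def by (intro continuous_intros) auto
qed

text \<open>Separates the dilation from the frequency: as long as \<open>h\<close> stays bounded,
  the weight of \<open>h * x\<close> is controlled by the weight of \<open>x\<close> alone.\<close>

lemma weight_mult_le: "s \<ge> 0 \<Longrightarrow> weight s (h * x) \<le> weight s h * weight s x"
proof -
  assume "s \<ge> 0"
  have "1 + (h * x)\<^sup>2 \<le> (1 + h\<^sup>2) * (1 + x\<^sup>2)"
    by (simp add: algebra_simps power_mult_distrib)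
  then have "weight s (h * x) \<le> ((1 + h\<^sup>2) * (1 + x\<^sup>2)) powr (s / 2)"
    unfolding weight_def using \<open>s \<ge> 0\<close> by (intro powr_mono2) auto
  then show ?thesis by (simp add: weight_def powr_mult)
qed

text \<open>Peetre's inequality. It makes translations bounded on the weighted space, with a norm of
  polynomial growth in the shift.\<close>

lemma weight_add_le: "s \<ge> 0 \<Longrightarrow> weight s (x + h) \<le> 2 powr (s / 2) * weight s h * weight s x"
proof -
  assume "s \<ge> 0"
  have "2 * (1 + h\<^sup>2) * (1 + x\<^sup>2) - (1 + (x + h)\<^sup>2) = 1 + (x - h)\<^sup>2 + 2 * (h * x)\<^sup>2"
    by (simp add: algebra_simps power2_eq_square)
  also have "\<dots> \<ge> 0" by simp
  finally have "(1 + (x + h)\<^sup>2) \<le> 2 * (1 + h\<^sup>2) * (1 + x\<^sup>2)" by simp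
  then have "weight s (x + h) \<le> (2 * (1 + h\<^sup>2) * (1 + x\<^sup>2)) powr (s / 2)"
    unfolding weight_def using \<open>s \<ge> 0\<close> by (intro powr_mono2) auto
  then show ?thesis by (simp add: weight_def powr_mult del: distrib_left_numeral)
qed

lemma weight_mono_abs: "s \<ge> 0 \<Longrightarrow> \<bar>x\<bar> \<le> \<bar>y\<bar> \<Longrightarrow> weight s x \<le> weight s y"
  unfolding weight_def by (intro powr_mono2) (auto simp: abs_le_square_iff)

text \<open>With \<open>F\<close> the Fourier transform of \<open>u\<close>, this is the square of the norm of \<open>u\<close> in
  \<open>H\<close> with exponent \<open>s / 2\<close>, not \<open>s\<close>.\<close>

definition wenergy :: "real \<Rightarrow> (real \<Rightarrow> complex) \<Rightarrow> ennreal" where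
  "wenergy s F = (\<integral>\<^sup>+\<xi>. ennreal (weight s \<xi> * (cmod (F \<xi>))\<^sup>2) \<partial>lborel)"

lemma wenergy_add_le:
  assumes [measurable]: "F \<in> borel_measurable borel" "G \<in> borel_measurable borel"
  shows "wenergy s (\<lambda>\<xi>. F \<xi> + G \<xi>) \<le> 2 * wenergy s F + 2 * wenergy s G"
proof -
  have "wenergy s (\<lambda>\<xi>. F \<xi> + G \<xi>) \<le> (\<integral>\<^sup>+\<xi>. 2 * ennreal (weight s \<xi> * (cmod (F \<xi>))\<^sup>2) + 2 * ennreal (weight s \<xi> * (cmod (G \<xi>))\<^sup>2) \<partial>lborel)"
    unfolding wenergy_def
  proof (intro nn_integral_mono)
    fix \<xi>
    have "weight s \<xi> * (cmod (F \<xi> + G \<xi>))\<^sup>2 \<le> weight s \<xi> * (2 * (cmod (F \<xi>))\<^sup>2 + 2 * (cmod (G \<xi>))\<^sup>2)"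
      by (intro mult_left_mono norm_add_sq_le) simp
    also have "\<dots> = 2 * (weight s \<xi> * (cmod (F \<xi>))\<^sup>2) + 2 * (weight s \<xi> * (cmod (G \<xi>))\<^sup>2)"
      by (simp add: algebra_simps)
    finally have "ennreal (weight s \<xi> * (cmod (F \<xi> + G \<xi>))\<^sup>2) \<le> ennreal (2 * (weight s \<xi> * (cmod (F \<xi>))\<^sup>2) + 2 * (weight s \<xi> * (cmod (G \<xi>))\<^sup>2))"
      by (rule ennreal_leI)
    then show "ennreal (weight s \<xi> * (cmod (F \<xi> + G \<xi>))\<^sup>2) \<le> 2 * ennreal (weight s \<xi> * (cmod (F \<xi>))\<^sup>2) + 2 * ennreal (weight s \<xi> * (cmod (G \<xi>))\<^sup>2)"
      by (simp add: ennreal_plus ennreal_mult'[of 2])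
  qed
  also have "\<dots> = 2 * wenergy s F + 2 * wenergy s G"
    unfolding wenergy_def by (subst nn_integral_add; simp add: nn_integral_cmult)
  finally show ?thesis .
qed

lemma wenergy_shift_le:
  assumes [measurable]: "U \<in> borel_measurable borel" and "s \<ge> 0"
  shows "wenergy s (\<lambda>\<xi>. U (\<xi> - h)) \<le> ennreal (2 powr (s / 2) * weight s h) * wenergy s U"
proof -
  have "wenergy s (\<lambda>\<xi>. U (\<xi> - h)) = (\<integral>\<^sup>+\<xi>. ennreal (weight s ((\<xi> - h) + h) * (cmod (U (\<xi> - h)))\<^sup>2) \<partial>lborel)"
    unfolding wenergy_def by simp
  also have "\<dots> = (\<integral>\<^sup>+\<xi>. ennreal (weight s (\<xi> + h) * (cmod (U \<xi>))\<^sup>2) \<partial>lborel)"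
    by (rule nn_integral_lborel_shift) simp
  also have "\<dots> \<le> (\<integral>\<^sup>+\<xi>. ennreal (2 powr (s / 2) * weight s h) * ennreal (weight s \<xi> * (cmod (U \<xi>))\<^sup>2) \<partial>lborel)"
  proof (intro nn_integral_mono)
    fix \<xi>
    have "weight s (\<xi> + h) * (cmod (U \<xi>))\<^sup>2 \<le> (2 powr (s / 2) * weight s h * weight s \<xi>) * (cmod (U \<xi>))\<^sup>2"
      by (intro mult_right_mono weight_add_le \<open>s \<ge> 0\<close>) simp
    then show "ennreal (weight s (\<xi> + h) * (cmod (U \<xi>))\<^sup>2) \<le> ennreal (2 powr (s / 2) * weight s h) * ennreal (weight s \<xi> * (cmod (U \<xi>))\<^sup>2)"
      by (subst ennreal_mult[symmetric]) (auto simp: mult.assoc)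
  qed
  also have "\<dots> = ennreal (2 powr (s / 2) * weight s h) * wenergy s U"
    unfolding wenergy_def by (rule nn_integral_cmult) simp
  finally show ?thesis .
qed

text \<open>The function \<open>G\<close>, the weight times the modulus of \<open>U\<close> times
  \<open>U\<close>, is integrable, and the square of a difference of values of \<open>U\<close> is
  controlled by a difference of values of \<open>G\<close>. Continuity of translation in the mean
  then applies to \<open>G\<close>. The weight is evaluated at two different points in the process,
  and the resulting error \<open>R\<close> tends to 0 by dominated convergence.\<close>

theorem translation_continuous_weighted_L2:
  assumes [measurable]: "U \<in> borel_measurable borel" and "s \<ge> 0" and fin: "wenergy s U < \<infinity>"
    and h: "h \<longlonglongrightarrow> 0"
  shows "(\<lambda>n. wenergy s (\<lambda>\<xi>. U (\<xi> - h n) - U \<xi>)) \<longlonglongrightarrow> 0"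
proof -
  define G where "G = (\<lambda>\<xi>. weight s \<xi> *\<^sub>R (cmod (U \<xi>) *\<^sub>R U \<xi>))"
  have [measurable]: "G \<in> borel_measurable borel" unfolding G_def by measurable
  have nG: "norm (G \<xi>) = weight s \<xi> * (cmod (U \<xi>))\<^sup>2" for \<xi>
    by (simp add: G_def power2_eq_square)
  have G: "integrable lborel G"
    using fin by (auto simp: integrable_iff_bounded nG wenergy_def)
  define R where "R = (\<lambda>n \<xi>. ennreal (\<bar>weight s (\<xi> + h n) - weight s \<xi>\<bar> * (cmod (U \<xi>))\<^sup>2))"
  obtain B where B: "\<And>n. \<bar>h n\<bar> \<le> B"
    using convergent_imp_Bseq[OF convergentI[OF h]] by (auto simp: Bseq_def)
  \<comment> \<open>Peetre's inequality bounds the shifted weight; the summand 1 accounts for the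
    unshifted one.\<close>
  define C where "C = 2 powr (s / 2) * weight s B + 1"
  have C: "C \<ge> 0" by (simp add: C_def)
  have Rlim: "(\<lambda>n. \<integral>\<^sup>+\<xi>. R n \<xi> \<partial>lborel) \<longlonglongrightarrow> (\<integral>\<^sup>+\<xi>. 0 \<partial>(lborel::real measure))"
  proof (rule nn_integral_dominated_convergence[where w="\<lambda>\<xi>. ennreal C * ennreal (weight s \<xi> * (cmod (U \<xi>))\<^sup>2)"])
    show "AE \<xi> in lborel. R n \<xi> \<le> ennreal C * ennreal (weight s \<xi> * (cmod (U \<xi>))\<^sup>2)" for n
    proof (rule AE_I2)
      fix \<xi>
      have "weight s (\<xi> + h n) \<le> 2 powr (s / 2) * weight s (h n) * weight s \<xi>"
        by (rule weight_add_le) fact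
      also have "\<dots> \<le> 2 powr (s / 2) * weight s B * weight s \<xi>"
        using B[of n] by (intro mult_right_mono mult_left_mono weight_mono_abs \<open>s \<ge> 0\<close>) auto
      finally have "\<bar>weight s (\<xi> + h n) - weight s \<xi>\<bar> \<le> C * weight s \<xi>"
        unfolding C_def distrib_right using weight_nonneg[of s "\<xi> + h n"] weight_nonneg[of s \<xi>]
          mult_nonneg_nonneg[OF mult_nonneg_nonneg[OF powr_ge_zero[of 2 "s / 2"] weight_nonneg[of s B]] weight_nonneg[of s \<xi>]]
        by linarith
      then have "\<bar>weight s (\<xi> + h n) - weight s \<xi>\<bar> * (cmod (U \<xi>))\<^sup>2 \<le> C * weight s \<xi> * (cmod (U \<xi>))\<^sup>2"
        by (rule mult_right_mono) simp
      then show "R n \<xi> \<le> ennreal C * ennreal (weight s \<xi> * (cmod (U \<xi>))\<^sup>2)"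
        unfolding R_def using C by (subst ennreal_mult[symmetric]) (auto simp: mult.assoc)
    qed
    show "AE \<xi> in lborel. (\<lambda>n. R n \<xi>) \<longlonglongrightarrow> 0"
    proof (rule AE_I2)
      fix \<xi>
      have "(\<lambda>n. \<xi> + h n) \<longlonglongrightarrow> \<xi>" using tendsto_add[OF tendsto_const h, of \<xi>] by simp
      then have "(\<lambda>n. weight s (\<xi> + h n)) \<longlonglongrightarrow> weight s \<xi>"
        by (rule isCont_tendsto_compose[OF continuous_weight])
      then have "(\<lambda>n. \<bar>weight s (\<xi> + h n) - weight s \<xi>\<bar> * (cmod (U \<xi>))\<^sup>2) \<longlonglongrightarrow> \<bar>weight s \<xi> - weight s \<xi>\<bar> * (cmod (U \<xi>))\<^sup>2"
        by (intro tendsto_intros)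
      then show "(\<lambda>n. R n \<xi>) \<longlonglongrightarrow> 0"
        unfolding R_def by (metis (no_types) abs_zero diff_self ennreal_0 mult_zero_left tendsto_ennrealI)
    qed
    show "(\<integral>\<^sup>+\<xi>. ennreal C * ennreal (weight s \<xi> * (cmod (U \<xi>))\<^sup>2) \<partial>lborel) < \<infinity>"
      using fin by (subst nn_integral_cmult) (auto simp: wenergy_def ennreal_mult_less_top)
  qed (auto simp: R_def)
  have "(\<lambda>n. 2 * (\<integral>\<^sup>+\<xi>. norm (G (\<xi> - h n) - G \<xi>) \<partial>lborel) + 2 * (\<integral>\<^sup>+\<xi>. R n \<xi> \<partial>lborel)) \<longlonglongrightarrow> 0"
    using translation_continuous_L1[OF G h] Rlim
    by (intro ennreal_tendsto_0_add ennreal_tendsto_0_cmult) auto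
  then show ?thesis
  proof (rule ennreal_tendsto_0_le)
    fix n
    have "wenergy s (\<lambda>\<xi>. U (\<xi> - h n) - U \<xi>) \<le> (\<integral>\<^sup>+\<xi>. 2 * ennreal (norm (G (\<xi> - h n) - G \<xi>)) + 2 * R n (\<xi> - h n) \<partial>lborel)"
      unfolding wenergy_def
    proof (intro nn_integral_mono)
      fix \<xi>
      define a b where "a = U (\<xi> - h n)" and "b = U \<xi>"
      have "weight s \<xi> * (cmod (a - b))\<^sup>2 \<le> weight s \<xi> * (2 * cmod (cmod a *\<^sub>R a - cmod b *\<^sub>R b))"
        by (intro mult_left_mono norm_diff_sq_le_norm_scaled_diff) simp
      also have "\<dots> = 2 * norm (weight s \<xi> *\<^sub>R (cmod a *\<^sub>R a - cmod b *\<^sub>R b))"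
        by simp
      \<comment> \<open>The weight at the shifted frequency is added and subtracted, so that the
        first term becomes a genuine increment of \<open>G\<close>.\<close>
      also have "weight s \<xi> *\<^sub>R (cmod a *\<^sub>R a - cmod b *\<^sub>R b)
          = (G (\<xi> - h n) - G \<xi>) + (weight s \<xi> - weight s (\<xi> - h n)) *\<^sub>R (cmod a *\<^sub>R a)"
        by (simp add: G_def a_def b_def algebra_simps)
      also have "norm \<dots> \<le> norm (G (\<xi> - h n) - G \<xi>) + norm ((weight s \<xi> - weight s (\<xi> - h n)) *\<^sub>R (cmod a *\<^sub>R a))"
        by (rule norm_triangle_ineq)
      also have "norm ((weight s \<xi> - weight s (\<xi> - h n)) *\<^sub>R (cmod a *\<^sub>R a)) = \<bar>weight s ((\<xi> - h n) + h n) - weight s (\<xi> - h n)\<bar> * (cmod a)\<^sup>2"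
        by (simp add: power2_eq_square abs_mult)
      finally have "weight s \<xi> * (cmod (a - b))\<^sup>2 \<le> 2 * norm (G (\<xi> - h n) - G \<xi>) + 2 * (\<bar>weight s ((\<xi> - h n) + h n) - weight s (\<xi> - h n)\<bar> * (cmod a)\<^sup>2)"
        by simp
      then have "ennreal (weight s \<xi> * (cmod (a - b))\<^sup>2) \<le> ennreal (2 * norm (G (\<xi> - h n) - G \<xi>) + 2 * (\<bar>weight s ((\<xi> - h n) + h n) - weight s (\<xi> - h n)\<bar> * (cmod a)\<^sup>2))"
        by (rule ennreal_leI)
      also have "\<dots> = 2 * ennreal (norm (G (\<xi> - h n) - G \<xi>)) + 2 * R n (\<xi> - h n)"
        unfolding R_def a_def by (subst ennreal_plus) (auto simp: ennreal_mult')
      finally show "ennreal (weight s \<xi> * (cmod (U (\<xi> - h n) - U \<xi>))\<^sup>2) \<le> 2 * ennreal (norm (G (\<xi> - h n) - G \<xi>)) + 2 * R n (\<xi> - h n)"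
        unfolding a_def b_def .
    qed
    also have "\<dots> = 2 * (\<integral>\<^sup>+\<xi>. norm (G (\<xi> - h n) - G \<xi>) \<partial>lborel) + 2 * (\<integral>\<^sup>+\<xi>. R n (\<xi> - h n) \<partial>lborel)"
      unfolding R_def by (subst nn_integral_add; simp add: nn_integral_cmult)
    also have "(\<integral>\<^sup>+\<xi>. R n (\<xi> - h n) \<partial>lborel) = (\<integral>\<^sup>+\<xi>. R n \<xi> \<partial>lborel)"
      unfolding R_def by (rule nn_integral_lborel_shift) simp
    finally show "wenergy s (\<lambda>\<xi>. U (\<xi> - h n) - U \<xi>) \<le> 2 * (\<integral>\<^sup>+\<xi>. norm (G (\<xi> - h n) - G \<xi>) \<partial>lborel) + 2 * (\<integral>\<^sup>+\<xi>. R n \<xi> \<partial>lborel)" .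
  qed
qed

section \<open>Averages against a kernel in the weighted space\<close>

text \<open>Cauchy-Schwarz with the modulus of \<open>K\<close> split into two square roots, one
  kept alone and one attached to \<open>F\<close>. If the product is not integrable, its Bochner
  integral is 0 and the bound is trivial.\<close>

lemma norm_integral_mult_sq_le:
  assumes [measurable]: "K \<in> borel_measurable M" "F \<in> borel_measurable M"
  shows "ennreal ((cmod (\<integral>x. K x * F x \<partial>M))\<^sup>2)
    \<le> (\<integral>\<^sup>+x. cmod (K x) \<partial>M) * (\<integral>\<^sup>+x. cmod (K x) * (cmod (F x))\<^sup>2 \<partial>M)"
proof (cases "integrable M (\<lambda>x. K x * F x)")
  case True
  have "ennreal (cmod (\<integral>x. K x * F x \<partial>M)) \<le> (\<integral>\<^sup>+x. cmod (K x * F x) \<partial>M)"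
    by (rule integral_norm_bound_ennreal[OF True])
  also have "\<dots> = (\<integral>\<^sup>+x. ennreal (sqrt (cmod (K x))) * ennreal (sqrt (cmod (K x)) * cmod (F x)) \<partial>M)"
    by (intro nn_integral_cong, subst ennreal_mult[symmetric]) (auto simp: norm_mult simp flip: mult.assoc)
  finally have "(ennreal (cmod (\<integral>x. K x * F x \<partial>M)))\<^sup>2 \<le> \<dots>\<^sup>2"
    by (rule power_mono) simp
  also have "\<dots> \<le> (\<integral>\<^sup>+x. (ennreal (sqrt (cmod (K x))))\<^sup>2 \<partial>M) * (\<integral>\<^sup>+x. (ennreal (sqrt (cmod (K x)) * cmod (F x)))\<^sup>2 \<partial>M)"
    by (rule Cauchy_Schwarz_nn_integral) auto
  also have "\<dots> = (\<integral>\<^sup>+x. cmod (K x) \<partial>M) * (\<integral>\<^sup>+x. cmod (K x) * (cmod (F x))\<^sup>2 \<partial>M)"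
    by (simp add: ennreal_power power_mult_distrib)
  finally show ?thesis by (simp add: ennreal_power)
qed (simp add: not_integrable_integral_eq)

text \<open>The pointwise Cauchy-Schwarz bound is integrated in \<xi> and Tonelli exchanges the
  integrals. It serves twice: for boundedness of the convolution, with \<open>G\<close> a translate
  of \<open>U\<close>, and for its convergence, with \<open>G\<close> a translate minus
  \<open>U\<close>.\<close>

lemma wenergy_integral_le:
  assumes [measurable]: "K \<in> borel_measurable borel" "case_prod G \<in> borel_measurable (borel \<Otimes>\<^sub>M borel)"
  shows "wenergy s (\<lambda>\<xi>. \<integral>\<eta>. K \<eta> * G \<xi> \<eta> \<partial>lborel)
    \<le> (\<integral>\<^sup>+\<eta>. cmod (K \<eta>) \<partial>lborel) * (\<integral>\<^sup>+\<eta>. cmod (K \<eta>) * wenergy s (\<lambda>\<xi>. G \<xi> \<eta>) \<partial>lborel)"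
proof -
  let ?c = "\<integral>\<^sup>+\<eta>. cmod (K \<eta>) \<partial>lborel"
  have "wenergy s (\<lambda>\<xi>. \<integral>\<eta>. K \<eta> * G \<xi> \<eta> \<partial>lborel)
      \<le> (\<integral>\<^sup>+\<xi>. ?c * (\<integral>\<^sup>+\<eta>. cmod (K \<eta>) * (weight s \<xi> * (cmod (G \<xi> \<eta>))\<^sup>2) \<partial>lborel) \<partial>lborel)"
    unfolding wenergy_def
  proof (intro nn_integral_mono)
    fix \<xi>
    have [measurable]: "G \<xi> \<in> borel_measurable borel"
      using measurable_Pair2[OF assms(2), of \<xi>] by simp
    have "ennreal (weight s \<xi> * (cmod (\<integral>\<eta>. K \<eta> * G \<xi> \<eta> \<partial>lborel))\<^sup>2)
        = ennreal (weight s \<xi>) * ennreal ((cmod (\<integral>\<eta>. K \<eta> * G \<xi> \<eta> \<partial>lborel))\<^sup>2)"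
      by (simp add: ennreal_mult)
    also have "\<dots> \<le> ennreal (weight s \<xi>) * (?c * (\<integral>\<^sup>+\<eta>. cmod (K \<eta>) * (cmod (G \<xi> \<eta>))\<^sup>2 \<partial>lborel))"
      by (intro mult_left_mono norm_integral_mult_sq_le) auto
    also have "\<dots> = ?c * (ennreal (weight s \<xi>) * (\<integral>\<^sup>+\<eta>. cmod (K \<eta>) * (cmod (G \<xi> \<eta>))\<^sup>2 \<partial>lborel))"
      by (simp add: ac_simps)
    also have "\<dots> = ?c * (\<integral>\<^sup>+\<eta>. cmod (K \<eta>) * (weight s \<xi> * (cmod (G \<xi> \<eta>))\<^sup>2) \<partial>lborel)"
      by (subst nn_integral_cmult[symmetric]) (auto simp: ac_simps simp flip: ennreal_mult)
    finally show "ennreal (weight s \<xi> * (cmod (\<integral>\<eta>. K \<eta> * G \<xi> \<eta> \<partial>lborel))\<^sup>2) \<le> \<dots>" .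
  qed
  also have "\<dots> = ?c * (\<integral>\<^sup>+\<xi>. (\<integral>\<^sup>+\<eta>. cmod (K \<eta>) * (weight s \<xi> * (cmod (G \<xi> \<eta>))\<^sup>2) \<partial>lborel) \<partial>lborel)"
    by (rule nn_integral_cmult) measurable
  also have "(\<integral>\<^sup>+\<xi>. (\<integral>\<^sup>+\<eta>. cmod (K \<eta>) * (weight s \<xi> * (cmod (G \<xi> \<eta>))\<^sup>2) \<partial>lborel) \<partial>lborel)
      = (\<integral>\<^sup>+\<eta>. (\<integral>\<^sup>+\<xi>. cmod (K \<eta>) * (weight s \<xi> * (cmod (G \<xi> \<eta>))\<^sup>2) \<partial>lborel) \<partial>lborel)"
    by (rule lborel_pair.Fubini') measurable
  also have "\<dots> = (\<integral>\<^sup>+\<eta>. cmod (K \<eta>) * wenergy s (\<lambda>\<xi>. G \<xi> \<eta>) \<partial>lborel)"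
  proof (intro nn_integral_cong)
    fix \<eta>
    have [measurable]: "(\<lambda>\<xi>. G \<xi> \<eta>) \<in> borel_measurable borel"
      using measurable_Pair1[OF assms(2), of \<eta>] by simp
    show "(\<integral>\<^sup>+\<xi>. cmod (K \<eta>) * (weight s \<xi> * (cmod (G \<xi> \<eta>))\<^sup>2) \<partial>lborel) = cmod (K \<eta>) * wenergy s (\<lambda>\<xi>. G \<xi> \<eta>)"
      unfolding wenergy_def by (subst nn_integral_cmult[symmetric]) (auto simp: ennreal_mult)
  qed
  finally show ?thesis .
qed

section \<open>Multiplication as convolution of Fourier transforms\<close>

lemma wenergy_cong_AE:
  assumes "AE \<xi> in lborel. F \<xi> = G \<xi>"
  shows "wenergy s F = wenergy s G"
  unfolding wenergy_def using assms by (intro nn_integral_cong_AE) auto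

text \<open>At exponent 0 the energy is the plain squared norm, so the estimates for
  \<open>wenergy\<close> also cover \<open>L2\<close> and the limit defining the Fourier
  transform.\<close>

lemma weight_0 [simp]: "weight 0 \<xi> = 1"
proof -
  have "1 + \<xi>\<^sup>2 > 0" by (simp add: add_pos_nonneg)
  then show ?thesis by (simp add: weight_def)
qed

lemma wenergy_0: "wenergy 0 F = (\<integral>\<^sup>+\<xi>. ennreal ((cmod (F \<xi>))\<^sup>2) \<partial>lborel)"
  by (simp add: wenergy_def)

lemma wenergy_0_le: "s \<ge> 0 \<Longrightarrow> wenergy 0 F \<le> wenergy s F"
  unfolding wenergy_def
  by (intro nn_integral_mono ennreal_leI mult_right_mono) (auto simp: weight_ge_1)

lemma L2_iff: "L2 u \<longleftrightarrow> u \<in> borel_measurable borel \<and> wenergy 0 u < \<infinity>"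
  by (auto simp: L2_def wenergy_0 integrable_iff_bounded)

lemma L2_measurable: "L2 u \<Longrightarrow> u \<in> borel_measurable borel"
  by (simp add: L2_iff)

lemma fourier_L2_iff:
  "fourier_L2 u U \<longleftrightarrow> L2 u \<and> L2 U \<and> (\<lambda>n. wenergy 0 (\<lambda>\<xi>. trunc_fourier u n \<xi> - U \<xi>)) \<longlonglongrightarrow> 0"
  by (simp add: fourier_L2_def wenergy_0)

lemma trunc_fourier_eq:
  "trunc_fourier u n \<xi> = (\<integral>x. indicator {-real n..real n} x *\<^sub>R (cis (- (2 * pi * x * \<xi>)) * u x) \<partial>lborel)"
  unfolding trunc_fourier_def set_lebesgue_integral_def
  by (simp add: cis_conv_exp mult_ac)

lemma le_1_plus_square: "a \<le> 1 + a\<^sup>2" for a :: real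
  using zero_le_power2[of "a - 1 / 2"] by (simp add: power2_eq_square algebra_simps)

text \<open>On a bounded interval square integrability implies integrability, since the modulus is
  at most 1 plus its square.\<close>

lemma L2_integrable_trunc:
  assumes "L2 u"
  shows "integrable lborel (\<lambda>x. indicator {-real n..real n} x *\<^sub>R u x)"
proof (rule Bochner_Integration.integrable_bound)
  have [measurable]: "u \<in> borel_measurable borel" using assms by (rule L2_measurable)
  show "integrable lborel (\<lambda>x. indicator {-real n..real n} x + (cmod (u x))\<^sup>2 :: real)"
    using assms by (intro Bochner_Integration.integrable_add) (auto simp: L2_def)
  show "AE x in lborel. norm (indicator {-real n..real n} x *\<^sub>R u x) \<le> norm (indicator {-real n..real n} x + (cmod (u x))\<^sup>2)"
  proof (rule AE_I2)
    fix x
    show "norm (indicator {-real n..real n} x *\<^sub>R u x) \<le> norm (indicator {-real n..real n} x + (cmod (u x))\<^sup>2)"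
      by (auto split: split_indicator intro: le_1_plus_square)
  qed
  show "(\<lambda>x. indicator {-real n..real n} x *\<^sub>R u x) \<in> borel_measurable lborel" by measurable
qed

lemma integrable_trunc_cis:
  assumes "L2 u" and [measurable]: "t \<in> borel_measurable borel"
  shows "integrable lborel (\<lambda>x. indicator {-real n..real n} x *\<^sub>R (cis (t x) * u x))"
proof (rule Bochner_Integration.integrable_bound[OF L2_integrable_trunc[OF assms(1), of n]])
  have [measurable]: "u \<in> borel_measurable borel" using assms(1) by (rule L2_measurable)
  show "(\<lambda>x. indicator {-real n..real n} x *\<^sub>R (cis (t x) * u x)) \<in> borel_measurable lborel"
    unfolding cis_conv_exp by measurable
qed (auto simp: norm_mult)

lemma trunc_fourier_measurable [measurable]:
  assumes [measurable]: "u \<in> borel_measurable borel"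
  shows "trunc_fourier u n \<in> borel_measurable borel"
  unfolding trunc_fourier_eq[abs_def] cis_conv_exp by measurable

lemma trunc_fourier_bounded:
  "cmod (trunc_fourier u n \<xi>) \<le> (\<integral>x. cmod (indicator {-real n..real n} x *\<^sub>R u x) \<partial>lborel)"
  unfolding trunc_fourier_eq
  by (rule order_trans[OF integral_norm_bound]) (simp add: norm_mult)

lemma trunc_fourier_diff:
  assumes "L2 u" "L2 v"
  shows "trunc_fourier (\<lambda>x. a * u x - v x) n \<xi> = a * trunc_fourier u n \<xi> - trunc_fourier v n \<xi>"
proof -
  have *: "indicator {-real n..real n} x *\<^sub>R (cis (- (2 * pi * x * \<xi>)) * (a * u x - v x))
    = a * (indicator {-real n..real n} x *\<^sub>R (cis (- (2 * pi * x * \<xi>)) * u x)) - indicator {-real n..real n} x *\<^sub>R (cis (- (2 * pi * x * \<xi>)) * v x)" for x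
    by (simp add: algebra_simps)
  have "integrable lborel (\<lambda>x. indicator {-real n..real n} x *\<^sub>R (cis (- (2 * pi * x * \<xi>)) * u x))"
    and "integrable lborel (\<lambda>x. indicator {-real n..real n} x *\<^sub>R (cis (- (2 * pi * x * \<xi>)) * v x))"
    using assms by (intro integrable_trunc_cis; simp)+
  then show ?thesis
    unfolding trunc_fourier_eq *
    by (subst Bochner_Integration.integral_diff[OF integrable_mult_right])
       (simp_all only: integral_mult_right_zero)
qed

section \<open>Dilated convolutions as Fourier transforms of products\<close>

definition inverse_fourier :: "(real \<Rightarrow> complex) \<Rightarrow> real \<Rightarrow> complex" where
  "inverse_fourier K x = (\<integral>\<eta>. K \<eta> * cis (2 * pi * x * \<eta>) \<partial>lborel)"

text \<open>For nonzero \<open>h\<close> this is the convolution of \<open>U\<close> with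
  \<open>K\<close> rescaled to width \<open>h\<close> and the same mass. Keeping the dilation inside
  the argument of \<open>U\<close> leaves the kernel fixed during the limit and includes
  \<open>h = 0\<close>.\<close>

definition dilated_conv :: "(real \<Rightarrow> complex) \<Rightarrow> real \<Rightarrow> (real \<Rightarrow> complex) \<Rightarrow> real \<Rightarrow> complex" where
  "dilated_conv K h U \<xi> = (\<integral>\<eta>. K \<eta> * U (\<xi> - h * \<eta>) \<partial>lborel)"

lemma integrable_pair_product_bound:
  fixes f :: "real \<Rightarrow> real \<Rightarrow> complex" and A B :: "real \<Rightarrow> real"
  assumes f_m[measurable]: "case_prod f \<in> borel_measurable (lborel \<Otimes>\<^sub>M lborel)"
    and nf: "\<And>x y. cmod (f x y) = A x * B y"
    and A: "integrable lborel A" and B: "integrable lborel B"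
  shows "integrable (lborel \<Otimes>\<^sub>M lborel) (case_prod f)"
proof (rule lborel_pair.Fubini_integrable[OF f_m])
  show "integrable lborel (\<lambda>x. \<integral>y. norm (case_prod f (x, y)) \<partial>lborel)"
    using A by (simp add: nf)
  show "AE x in lborel. integrable lborel (\<lambda>y. case_prod f (x, y))"
  proof (rule AE_I2)
    fix x
    have "f x \<in> borel_measurable lborel"
      using measurable_Pair2[OF f_m, of x] by simp
    moreover have "integrable lborel (\<lambda>y. A x * B y)" using B by simp
    moreover have "AE y in lborel. norm (f x y) \<le> norm (A x * B y)"
      by (simp add: nf)
    ultimately have "integrable lborel (\<lambda>y. f x y)"
      using Bochner_Integration.integrable_bound by blast
    then show "integrable lborel (\<lambda>y. case_prod f (x, y))" by simp
  qed
qed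

text \<open>The truncated \<open>u\<close> and \<open>K\<close> are both integrable, so Fubini
  applies, and modulation by \<open>cis (2 * pi * h * x * \<eta>)\<close> shifts the frequency by
  \<open>h * \<eta>\<close>. The identity is exact at each truncation level and at each
  frequency.\<close>

lemma trunc_fourier_inverse_fourier_mult:
  assumes K: "integrable lborel K" and u: "L2 u"
  shows "trunc_fourier (\<lambda>x. inverse_fourier K (h * x) * u x) n \<xi> = dilated_conv K h (trunc_fourier u n) \<xi>"
proof -
  have [measurable]: "u \<in> borel_measurable borel" "K \<in> borel_measurable borel"
    using u borel_measurable_integrable[OF K] by (auto simp: L2_iff)
  define v where "v = (\<lambda>x. indicator {-real n..real n} x *\<^sub>R u x)"
  have [measurable]: "v \<in> borel_measurable borel" unfolding v_def by measurable
  have v: "integrable lborel v" unfolding v_def by (rule L2_integrable_trunc[OF u])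
  define f where "f = (\<lambda>x \<eta>. K \<eta> * (cis (- (2 * pi * x * (\<xi> - h * \<eta>))) * v x))"
  have f_m: "case_prod f \<in> borel_measurable (lborel \<Otimes>\<^sub>M lborel)"
    unfolding f_def cis_conv_exp by measurable
  have nf: "norm (f x \<eta>) = cmod (v x) * cmod (K \<eta>)" for x \<eta>
    by (simp add: f_def norm_mult)
  have int: "integrable (lborel \<Otimes>\<^sub>M lborel) (case_prod f)"
    by (rule integrable_pair_product_bound[OF f_m nf]) (use v K in auto)
  have "trunc_fourier (\<lambda>x. inverse_fourier K (h * x) * u x) n \<xi> = (\<integral>x. (\<integral>\<eta>. f x \<eta> \<partial>lborel) \<partial>lborel)"
    unfolding trunc_fourier_eq
  proof (rule Bochner_Integration.integral_cong[OF refl])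
    fix x
    have "(\<integral>\<eta>. f x \<eta> \<partial>lborel) = (\<integral>\<eta>. (cis (- (2 * pi * x * \<xi>)) * v x) * (K \<eta> * cis (2 * pi * (h * x) * \<eta>)) \<partial>lborel)"
    proof (rule Bochner_Integration.integral_cong[OF refl])
      fix \<eta>
      have "cis (- (2 * pi * x * (\<xi> - h * \<eta>))) = cis (- (2 * pi * x * \<xi>)) * cis (2 * pi * (h * x) * \<eta>)"
        by (simp add: cis_mult algebra_simps)
      then show "f x \<eta> = (cis (- (2 * pi * x * \<xi>)) * v x) * (K \<eta> * cis (2 * pi * (h * x) * \<eta>))"
        by (simp add: f_def)
    qed
    also have "\<dots> = (cis (- (2 * pi * x * \<xi>)) * v x) * inverse_fourier K (h * x)"
      by (simp add: inverse_fourier_def)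
    finally show "indicator {-real n..real n} x *\<^sub>R (cis (- (2 * pi * x * \<xi>)) * (inverse_fourier K (h * x) * u x)) = (\<integral>\<eta>. f x \<eta> \<partial>lborel)"
      by (simp add: v_def)
  qed
  also have "\<dots> = (\<integral>\<eta>. (\<integral>x. f x \<eta> \<partial>lborel) \<partial>lborel)"
    by (rule lborel_pair.Fubini_integral[OF int, symmetric])
  also have "\<dots> = dilated_conv K h (trunc_fourier u n) \<xi>"
    unfolding dilated_conv_def trunc_fourier_eq
  proof (rule Bochner_Integration.integral_cong[OF refl])
    fix \<eta>
    have "(\<integral>x. f x \<eta> \<partial>lborel) = K \<eta> * (\<integral>x. cis (- (2 * pi * x * (\<xi> - h * \<eta>))) * v x \<partial>lborel)"
      unfolding f_def by simp
    also have "\<dots> = K \<eta> * (\<integral>x. indicator {-real n..real n} x *\<^sub>R (cis (- (2 * pi * x * (\<xi> - h * \<eta>))) * u x) \<partial>lborel)"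
      by (simp add: v_def)
    finally show "(\<integral>x. f x \<eta> \<partial>lborel) = \<dots>" .
  qed
  finally show ?thesis .
qed

lemma dilated_conv_measurable [measurable]:
  assumes [measurable]: "K \<in> borel_measurable borel" "U \<in> borel_measurable borel"
  shows "dilated_conv K h U \<in> borel_measurable borel"
  unfolding dilated_conv_def[abs_def] by measurable

lemma nn_integral_norm_finite: "integrable M (K :: _ \<Rightarrow> _ :: {banach, second_countable_topology}) \<Longrightarrow> (\<integral>\<^sup>+x. ennreal (norm (K x)) \<partial>M) < \<infinity>"
  unfolding integrable_iff_bounded by blast

lemma wenergy_0_shift:
  assumes [measurable]: "U \<in> borel_measurable borel"
  shows "wenergy 0 (\<lambda>\<xi>. U (\<xi> - h)) = wenergy 0 U"
  unfolding wenergy_0 by (rule nn_integral_lborel_shift) simp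

text \<open>Young's inequality for an integrable and a square integrable factor, with a constant
  independent of \<open>h\<close>.\<close>

lemma wenergy_0_dilated_conv_le:
  assumes K[measurable]: "K \<in> borel_measurable borel" and [measurable]: "U \<in> borel_measurable borel"
  shows "wenergy 0 (dilated_conv K h U) \<le> (\<integral>\<^sup>+\<eta>. cmod (K \<eta>) \<partial>lborel)\<^sup>2 * wenergy 0 U"
proof -
  have "wenergy 0 (dilated_conv K h U) \<le> (\<integral>\<^sup>+\<eta>. cmod (K \<eta>) \<partial>lborel) * (\<integral>\<^sup>+\<eta>. cmod (K \<eta>) * wenergy 0 (\<lambda>\<xi>. U (\<xi> - h * \<eta>)) \<partial>lborel)"
    unfolding dilated_conv_def[abs_def] by (rule wenergy_integral_le) measurable
  also have "\<dots> = (\<integral>\<^sup>+\<eta>. cmod (K \<eta>) \<partial>lborel) * ((\<integral>\<^sup>+\<eta>. cmod (K \<eta>) \<partial>lborel) * wenergy 0 U)"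
    by (simp add: wenergy_0_shift nn_integral_multc)
  finally show ?thesis by (simp add: power2_eq_square mult.assoc)
qed

text \<open>Bochner integrals are additive only for integrable integrands, so splitting
  \<open>dilated_conv\<close> of a difference needs this at almost every frequency. By Tonelli the
  integral of the modulus of \<open>K\<close> times the square of the translated \<open>U\<close> is
  finite almost everywhere, and the modulus of \<open>U\<close> is at most 1 plus its
  square.\<close>

lemma dilated_conv_AE_integrable:
  assumes K: "integrable lborel K" and [measurable]: "U \<in> borel_measurable borel" and fin: "wenergy 0 U < \<infinity>"
  shows "AE \<xi> in lborel. integrable lborel (\<lambda>\<eta>. K \<eta> * U (\<xi> - h * \<eta>))"
proof -
  have [measurable]: "K \<in> borel_measurable borel" using borel_measurable_integrable[OF K] by simp
  have "(\<integral>\<^sup>+\<xi>. (\<integral>\<^sup>+\<eta>. cmod (K \<eta>) * (cmod (U (\<xi> - h * \<eta>)))\<^sup>2 \<partial>lborel) \<partial>lborel)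
      = (\<integral>\<^sup>+\<eta>. (\<integral>\<^sup>+\<xi>. cmod (K \<eta>) * (cmod (U (\<xi> - h * \<eta>)))\<^sup>2 \<partial>lborel) \<partial>lborel)"
    by (rule lborel_pair.Fubini') measurable
  also have "\<dots> = (\<integral>\<^sup>+\<eta>. cmod (K \<eta>) * wenergy 0 (\<lambda>\<xi>. U (\<xi> - h * \<eta>)) \<partial>lborel)"
    unfolding wenergy_0 by (simp add: nn_integral_cmult ennreal_mult)
  also have "\<dots> = (\<integral>\<^sup>+\<eta>. cmod (K \<eta>) \<partial>lborel) * wenergy 0 U"
    by (simp add: wenergy_0_shift nn_integral_multc)
  also have "\<dots> < \<infinity>"
    using nn_integral_norm_finite[OF K] fin by (simp add: ennreal_mult_less_top)
  finally have "AE \<xi> in lborel. (\<integral>\<^sup>+\<eta>. cmod (K \<eta>) * (cmod (U (\<xi> - h * \<eta>)))\<^sup>2 \<partial>lborel) \<noteq> \<infinity>"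
    by (intro nn_integral_PInf_AE) auto
  then show ?thesis
  proof eventually_elim
    case (elim \<xi>)
    have "integrable lborel (\<lambda>\<eta>. cmod (K \<eta>) * (cmod (U (\<xi> - h * \<eta>)))\<^sup>2)"
      using elim by (auto simp: integrable_iff_bounded less_top)
    then have "integrable lborel (\<lambda>\<eta>. cmod (K \<eta>) + cmod (K \<eta>) * (cmod (U (\<xi> - h * \<eta>)))\<^sup>2)"
      using K by auto
    then show ?case
    proof (rule Bochner_Integration.integrable_bound)
      show "AE \<eta> in lborel. norm (K \<eta> * U (\<xi> - h * \<eta>)) \<le> norm (cmod (K \<eta>) + cmod (K \<eta>) * (cmod (U (\<xi> - h * \<eta>)))\<^sup>2)"
      proof (rule AE_I2)
        fix \<eta>
        define a where "a = cmod (U (\<xi> - h * \<eta>))"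
        have "cmod (K \<eta>) * a \<le> cmod (K \<eta>) * (1 + a\<^sup>2)" by (intro mult_left_mono le_1_plus_square) auto
        then show "norm (K \<eta> * U (\<xi> - h * \<eta>)) \<le> norm (cmod (K \<eta>) + cmod (K \<eta>) * (cmod (U (\<xi> - h * \<eta>)))\<^sup>2)"
          by (simp add: norm_mult a_def distrib_left)
      qed
    qed measurable
  qed
qed

lemma inverse_fourier_measurable [measurable]:
  assumes [measurable]: "K \<in> borel_measurable borel"
  shows "inverse_fourier K \<in> borel_measurable borel"
  unfolding inverse_fourier_def[abs_def] cis_conv_exp by measurable

lemma inverse_fourier_bounded: "cmod (inverse_fourier K x) \<le> (\<integral>\<eta>. cmod (K \<eta>) \<partial>lborel)"
  unfolding inverse_fourier_def by (rule order_trans[OF integral_norm_bound]) (simp add: norm_mult)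

text \<open>The exact identity for truncations passes to the limit because convolution with
  \<open>K\<close> is bounded by Young's inequality.\<close>

theorem fourier_L2_inverse_fourier_mult:
  assumes K: "integrable lborel K" and u: "fourier_L2 u U"
  shows "fourier_L2 (\<lambda>x. inverse_fourier K (h * x) * u x) (dilated_conv K h U)"
  unfolding fourier_L2_iff
proof (intro conjI)
  have [measurable]: "K \<in> borel_measurable borel" using borel_measurable_integrable[OF K] by simp
  have L: "L2 u" "L2 U" and lim: "(\<lambda>n. wenergy 0 (\<lambda>\<xi>. trunc_fourier u n \<xi> - U \<xi>)) \<longlonglongrightarrow> 0"
    using u by (auto simp: fourier_L2_iff)
  then have [measurable]: "u \<in> borel_measurable borel" "U \<in> borel_measurable borel"
    by (auto simp: L2_iff)
  define k where "k = (\<integral>\<eta>. cmod (K \<eta>) \<partial>lborel)"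
  show "L2 (\<lambda>x. inverse_fourier K (h * x) * u x)"
    unfolding L2_def
  proof
    have "integrable lborel (\<lambda>x. k\<^sup>2 * (cmod (u x))\<^sup>2)" using L by (simp add: L2_def)
    then show "integrable lborel (\<lambda>x. (cmod (inverse_fourier K (h * x) * u x))\<^sup>2)"
      by (rule Bochner_Integration.integrable_bound)
         (auto simp: norm_mult power_mult_distrib k_def intro!: mult_right_mono power_mono inverse_fourier_bounded)
  qed measurable
  have kfin: "(\<integral>\<^sup>+\<eta>. cmod (K \<eta>) \<partial>lborel)\<^sup>2 < \<infinity>"
    using nn_integral_norm_finite[OF K] by (simp add: power2_eq_square ennreal_mult_less_top)
  show "L2 (dilated_conv K h U)"
    unfolding L2_iff using L kfin
    by (auto intro!: le_less_trans[OF wenergy_0_dilated_conv_le] simp: ennreal_mult_less_top L2_iff)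
  have "(\<lambda>n. (\<integral>\<^sup>+\<eta>. cmod (K \<eta>) \<partial>lborel)\<^sup>2 * wenergy 0 (\<lambda>\<xi>. trunc_fourier u n \<xi> - U \<xi>)) \<longlonglongrightarrow> 0"
    using lim kfin by (rule ennreal_tendsto_0_cmult)
  then show "(\<lambda>n. wenergy 0 (\<lambda>\<xi>. trunc_fourier (\<lambda>x. inverse_fourier K (h * x) * u x) n \<xi> - dilated_conv K h U \<xi>)) \<longlonglongrightarrow> 0"
  proof (rule ennreal_tendsto_0_le)
    fix n
    have AE: "AE \<xi> in lborel. integrable lborel (\<lambda>\<eta>. K \<eta> * U (\<xi> - h * \<eta>))"
      using L by (intro dilated_conv_AE_integrable K) (auto simp: L2_iff)
    have "AE \<xi> in lborel. trunc_fourier (\<lambda>x. inverse_fourier K (h * x) * u x) n \<xi> - dilated_conv K h U \<xi> = dilated_conv K h (\<lambda>\<xi>. trunc_fourier u n \<xi> - U \<xi>) \<xi>"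
      using AE
    proof eventually_elim
      case (elim \<xi>)
      \<comment> \<open>Truncated transforms are bounded functions, so their product with a
        translate-independent integrable \<open>K\<close> is integrable at every frequency.\<close>
      define M where "M = (\<integral>x. cmod (indicator {-real n..real n} x *\<^sub>R u x) \<partial>lborel)"
      have "integrable lborel (\<lambda>\<eta>. K \<eta> * trunc_fourier u n (\<xi> - h * \<eta>))"
      proof (rule Bochner_Integration.integrable_bound)
        show "integrable lborel (\<lambda>\<eta>. cmod (K \<eta>) * M)" using K by simp
        have "cmod (trunc_fourier u n \<zeta>) \<le> \<bar>M\<bar>" for \<zeta>
          using trunc_fourier_bounded[of u n \<zeta>] unfolding M_def by linarith
        then show "AE \<eta> in lborel. norm (K \<eta> * trunc_fourier u n (\<xi> - h * \<eta>)) \<le> norm (cmod (K \<eta>) * M)"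
          by (auto simp: norm_mult abs_mult intro!: mult_left_mono)
      qed measurable
      with elim show ?case
        unfolding trunc_fourier_inverse_fourier_mult[OF K L(1)]
        unfolding dilated_conv_def by (simp add: right_diff_distrib)
    qed
    then have "wenergy 0 (\<lambda>\<xi>. trunc_fourier (\<lambda>x. inverse_fourier K (h * x) * u x) n \<xi> - dilated_conv K h U \<xi>) = wenergy 0 (dilated_conv K h (\<lambda>\<xi>. trunc_fourier u n \<xi> - U \<xi>))"
      by (rule wenergy_cong_AE)
    also have "\<dots> \<le> (\<integral>\<^sup>+\<eta>. cmod (K \<eta>) \<partial>lborel)\<^sup>2 * wenergy 0 (\<lambda>\<xi>. trunc_fourier u n \<xi> - U \<xi>)"
      by (rule wenergy_0_dilated_conv_le) measurable
    finally show "wenergy 0 (\<lambda>\<xi>. trunc_fourier (\<lambda>x. inverse_fourier K (h * x) * u x) n \<xi> - dilated_conv K h U \<xi>) \<le> \<dots>" .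
  qed
qed

text \<open>Subtracting the mass of \<open>K\<close> times \<open>U\<close> leaves an average of
  increments \<open>U (\<xi> - h n * \<eta>) - U \<xi>\<close>. Their energy
  \<open>J (h n * \<eta>)\<close> tends to 0 for each fixed \<eta> and is at most a multiple of
  \<open>weight s \<eta>\<close>, uniformly in \<open>n\<close>; the hypothesis \<open>Kw\<close>
  makes this bound a dominating function.\<close>

theorem dilated_conv_tendsto:
  assumes K: "integrable lborel K" and Kw: "integrable lborel (\<lambda>\<eta>. cmod (K \<eta>) * weight s \<eta>)"
    and [measurable]: "U \<in> borel_measurable borel" and fin: "wenergy s U < \<infinity>" and s: "s \<ge> 0"
    and h: "h \<longlonglongrightarrow> 0"
  shows "(\<lambda>n. wenergy s (\<lambda>\<xi>. dilated_conv K (h n) U \<xi> - (\<integral>\<eta>. K \<eta> \<partial>lborel) * U \<xi>)) \<longlonglongrightarrow> 0"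
proof -
  have [measurable]: "K \<in> borel_measurable borel" using borel_measurable_integrable[OF K] by simp
  define J where "J = (\<lambda>k. wenergy s (\<lambda>\<xi>. U (\<xi> - k) - U \<xi>))"
  have [measurable]: "J \<in> borel_measurable borel" unfolding J_def wenergy_def by measurable
  obtain B where B: "\<And>n. \<bar>h n\<bar> \<le> B"
    using convergent_imp_Bseq[OF convergentI[OF h]] by (auto simp: Bseq_def)
  \<comment> \<open>The factor 2 comes from the energy of a sum, the product from the shifted
    \<open>U\<close>, and the summand 1 from the unshifted \<open>U\<close>, whose contribution is
    absorbed because the weight is at least 1.\<close>
  define C where "C = 2 * (2 powr (s / 2) * weight s B + 1)"
  have C: "C \<ge> 0" by (simp add: C_def)
  have Jb: "J (h n * \<eta>) \<le> ennreal (C * weight s \<eta>) * wenergy s U" for n \<eta>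
  proof -
    have "J (h n * \<eta>) \<le> 2 * wenergy s (\<lambda>\<xi>. U (\<xi> - h n * \<eta>)) + 2 * wenergy s (\<lambda>\<xi>. - U \<xi>)"
      unfolding J_def using wenergy_add_le[of "\<lambda>\<xi>. U (\<xi> - h n * \<eta>)" "\<lambda>\<xi>. - U \<xi>" s] by simp
    also have "wenergy s (\<lambda>\<xi>. - U \<xi>) = wenergy s U" by (simp add: wenergy_def)
    also have "wenergy s (\<lambda>\<xi>. U (\<xi> - h n * \<eta>)) \<le> ennreal (2 powr (s / 2) * weight s (h n * \<eta>)) * wenergy s U"
      by (rule wenergy_shift_le) (use s in auto)
    also have "ennreal (2 powr (s / 2) * weight s (h n * \<eta>)) \<le> ennreal (2 powr (s / 2) * (weight s B * weight s \<eta>))"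
    proof (intro ennreal_leI mult_left_mono)
      have "weight s (h n * \<eta>) \<le> weight s (h n) * weight s \<eta>" by (rule weight_mult_le[OF s])
      also have "\<dots> \<le> weight s B * weight s \<eta>"
        using B[of n] by (intro mult_right_mono weight_mono_abs s) auto
      finally show "weight s (h n * \<eta>) \<le> weight s B * weight s \<eta>" .
    qed simp
    finally have "J (h n * \<eta>) \<le> 2 * (ennreal (2 powr (s / 2) * (weight s B * weight s \<eta>)) * wenergy s U) + 2 * wenergy s U"
      by (simp add: mult_left_mono mult_right_mono add_mono)
    also have "\<dots> = (ennreal (2 * (2 powr (s / 2) * (weight s B * weight s \<eta>))) + ennreal 2) * wenergy s U"
      by (simp add: distrib_right ennreal_mult'[of 2] mult.assoc)
    also have "\<dots> = ennreal (2 * (2 powr (s / 2) * (weight s B * weight s \<eta>)) + 2) * wenergy s U"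
      by (subst ennreal_plus) auto
    also have "\<dots> \<le> ennreal (C * weight s \<eta>) * wenergy s U"
      unfolding C_def using weight_ge_1[OF s, of \<eta>]
      by (intro mult_right_mono ennreal_leI) (auto simp: algebra_simps)
    finally show ?thesis .
  qed
  have "(\<lambda>n. \<integral>\<^sup>+\<eta>. cmod (K \<eta>) * J (h n * \<eta>) \<partial>lborel) \<longlonglongrightarrow> (\<integral>\<^sup>+\<eta>. 0 \<partial>(lborel::real measure))"
  proof (rule nn_integral_dominated_convergence[where w="\<lambda>\<eta>. ennreal (cmod (K \<eta>) * weight s \<eta>) * (ennreal C * wenergy s U)"])
    show "AE \<eta> in lborel. ennreal (cmod (K \<eta>)) * J (h n * \<eta>) \<le> ennreal (cmod (K \<eta>) * weight s \<eta>) * (ennreal C * wenergy s U)" for n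
    proof (rule AE_I2)
      fix \<eta>
      have "ennreal (cmod (K \<eta>)) * J (h n * \<eta>) \<le> ennreal (cmod (K \<eta>)) * (ennreal (C * weight s \<eta>) * wenergy s U)"
        by (intro mult_left_mono Jb) simp
      then show "ennreal (cmod (K \<eta>)) * J (h n * \<eta>) \<le> ennreal (cmod (K \<eta>) * weight s \<eta>) * (ennreal C * wenergy s U)"
        using C by (simp add: ennreal_mult mult_ac)
    qed
    show "AE \<eta> in lborel. (\<lambda>n. ennreal (cmod (K \<eta>)) * J (h n * \<eta>)) \<longlonglongrightarrow> 0"
    proof (rule AE_I2)
      fix \<eta>
      have "(\<lambda>n. h n * \<eta>) \<longlonglongrightarrow> 0" using tendsto_mult_right[OF h, of \<eta>] by simp
      then have "(\<lambda>n. J (h n * \<eta>)) \<longlonglongrightarrow> 0"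
        unfolding J_def using fin s by (intro translation_continuous_weighted_L2) auto
      then show "(\<lambda>n. ennreal (cmod (K \<eta>)) * J (h n * \<eta>)) \<longlonglongrightarrow> 0"
        by (rule ennreal_tendsto_0_cmult) simp
    qed
    show "(\<integral>\<^sup>+\<eta>. ennreal (cmod (K \<eta>) * weight s \<eta>) * (ennreal C * wenergy s U) \<partial>lborel) < \<infinity>"
      using fin nn_integral_norm_finite[OF Kw]
      by (subst nn_integral_multc) (auto simp: ennreal_mult_less_top)
  qed auto
  then have "(\<lambda>n. (\<integral>\<^sup>+\<eta>. cmod (K \<eta>) \<partial>lborel) * (\<integral>\<^sup>+\<eta>. cmod (K \<eta>) * J (h n * \<eta>) \<partial>lborel)) \<longlonglongrightarrow> 0"
    using nn_integral_norm_finite[OF K] by (intro ennreal_tendsto_0_cmult) auto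
  then show ?thesis
  proof (rule ennreal_tendsto_0_le)
    fix n
    have "wenergy 0 U < \<infinity>" using wenergy_0_le[OF s, of U] fin by simp
    then have AE: "AE \<xi> in lborel. integrable lborel (\<lambda>\<eta>. K \<eta> * U (\<xi> - h n * \<eta>))"
      by (intro dilated_conv_AE_integrable K) auto
    have "AE \<xi> in lborel. dilated_conv K (h n) U \<xi> - (\<integral>\<eta>. K \<eta> \<partial>lborel) * U \<xi> = (\<integral>\<eta>. K \<eta> * (U (\<xi> - h n * \<eta>) - U \<xi>) \<partial>lborel)"
      using AE
    proof eventually_elim
      case (elim \<xi>)
      then show ?case using K by (simp add: dilated_conv_def right_diff_distrib)
    qed
    then have "wenergy s (\<lambda>\<xi>. dilated_conv K (h n) U \<xi> - (\<integral>\<eta>. K \<eta> \<partial>lborel) * U \<xi>)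
      = wenergy s (\<lambda>\<xi>. \<integral>\<eta>. K \<eta> * (U (\<xi> - h n * \<eta>) - U \<xi>) \<partial>lborel)"
      by (rule wenergy_cong_AE)
    also have "\<dots> \<le> (\<integral>\<^sup>+\<eta>. cmod (K \<eta>) \<partial>lborel) * (\<integral>\<^sup>+\<eta>. cmod (K \<eta>) * J (h n * \<eta>) \<partial>lborel)"
      unfolding J_def by (rule wenergy_integral_le) measurable
    finally show "wenergy s (\<lambda>\<xi>. dilated_conv K (h n) U \<xi> - (\<integral>\<eta>. K \<eta> \<partial>lborel) * U \<xi>) \<le> \<dots>" .
  qed
qed

section \<open>Fourier transforms of smooth functions with compact support\<close>

text \<open>Asking for some derivative function, instead of iterating \<open>deriv\<close>, makes
  closure under sums and products a direct induction on the order.\<close>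

primrec Ck :: "nat \<Rightarrow> (real \<Rightarrow> real) \<Rightarrow> bool" where
  "Ck 0 f \<longleftrightarrow> continuous_on UNIV f"
| "Ck (Suc k) f \<longleftrightarrow> (\<exists>f'. (\<forall>x. (f has_real_derivative f' x) (at x)) \<and> Ck k f')"

lemma Ck_continuous: "Ck k f \<Longrightarrow> continuous_on UNIV f"
  by (cases k) (auto intro!: continuous_at_imp_continuous_on intro: DERIV_isCont)

lemma Ck_Suc_imp: "Ck (Suc k) f \<Longrightarrow> Ck k f"
proof (induction k arbitrary: f)
  case 0
  then show ?case using Ck_continuous[of "Suc 0" f] by simp
next
  case (Suc k)
  then show ?case by (metis Ck.simps(2))
qed

lemma Ck_const: "Ck k (\<lambda>_. c)"
proof (induction k arbitrary: c)
  case (Suc k)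
  have "\<forall>x. ((\<lambda>_. c) has_real_derivative 0) (at x)" by simp
  with Suc[of 0] show ?case unfolding Ck.simps by (intro exI[of _ "\<lambda>_. 0"] conjI)
qed simp

lemma Ck_add: "Ck k f \<Longrightarrow> Ck k g \<Longrightarrow> Ck k (\<lambda>x. f x + g x)"
proof (induction k arbitrary: f g)
  case (Suc k)
  then obtain f' g' where "\<forall>x. (f has_real_derivative f' x) (at x)" "Ck k f'"
    "\<forall>x. (g has_real_derivative g' x) (at x)" "Ck k g'" by auto
  then show ?case
    using Suc.IH[of f' g'] by (auto intro!: exI[of _ "\<lambda>x. f' x + g' x"] DERIV_add)
qed (auto intro: continuous_intros)

lemma Ck_mult: "Ck k f \<Longrightarrow> Ck k g \<Longrightarrow> Ck k (\<lambda>x. f x * g x)"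
proof (induction k arbitrary: f g)
  case (Suc k)
  then obtain f' g' where d: "\<And>x. (f has_real_derivative f' x) (at x)" "Ck k f'"
    "\<And>x. (g has_real_derivative g' x) (at x)" "Ck k g'" by auto
  have "((\<lambda>x. f x * g x) has_real_derivative f' x * g x + g' x * f x) (at x)" for x
    using DERIV_mult[OF d(1,3)] .
  moreover have "Ck k (\<lambda>x. f' x * g x + g' x * f x)"
    using Suc.prems[THEN Ck_Suc_imp] by (intro Ck_add Suc.IH d)
  ultimately show ?case
    unfolding Ck.simps by (intro exI[of _ "\<lambda>x. f' x * g x + g' x * f x"] conjI allI)
qed (auto intro: continuous_intros)

lemma smooth_imp_Ck:
  assumes "smooth f"
  shows "Ck k f"
proof -
  have D: "((deriv ^^ j) f has_real_derivative (deriv ^^ Suc j) f x) (at x)" for j x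
    using assms unfolding smooth_def by (simp add: DERIV_deriv_iff_real_differentiable)
  have "Ck k ((deriv ^^ j) f)" for j
  proof (induction k arbitrary: j)
    case 0
    show ?case using D by (auto intro!: continuous_at_imp_continuous_on DERIV_isCont)
  next
    case (Suc k)
    show ?case using D[of j] Suc.IH[of "Suc j"] by auto
  qed
  from this[of 0] show ?thesis by simp
qed

section \<open>Decay of the Fourier transform of a compactly supported function\<close>

definition fourier_L1 :: "(real \<Rightarrow> real) \<Rightarrow> real \<Rightarrow> complex" where
  "fourier_L1 f \<eta> = (\<integral>x. of_real (f x) * cis (- (2 * pi * x * \<eta>)) \<partial>lborel)"

lemma fourier_L1_measurable [measurable]:
  assumes [measurable]: "f \<in> borel_measurable borel"
  shows "fourier_L1 f \<in> borel_measurable borel"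
  unfolding fourier_L1_def[abs_def] cis_conv_exp by measurable

lemma fourier_L1_bounded: "cmod (fourier_L1 f \<eta>) \<le> (\<integral>x. \<bar>f x\<bar> \<partial>lborel)"
  unfolding fourier_L1_def by (rule order_trans[OF integral_norm_bound]) (simp add: norm_mult)

lemma integrable_compact_support:
  fixes g :: "real \<Rightarrow> 'a :: {banach, second_countable_topology}"
  assumes "continuous_on UNIV g" "\<And>x. \<bar>x\<bar> > R \<Longrightarrow> g x = 0"
  shows "integrable lborel g"
proof -
  have "integrable lborel (\<lambda>x. indicator {-R..R} x *\<^sub>R g x)"
    by (intro borel_integrable_compact continuous_on_subset[OF assms(1)]) auto
  also have "(\<lambda>x. indicator {-R..R} x *\<^sub>R g x) = g"
    using assms(2) by (auto simp: fun_eq_iff split: split_indicator)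
  finally show ?thesis .
qed

lemma continuous_on_cis_linear: "continuous_on UNIV (\<lambda>x. cis (- (2 * pi * x * \<eta>)))"
  unfolding cis_conv_exp by (intro continuous_intros)

text \<open>Integration by parts in disguise: \<open>G\<close> is the derivative of \<open>f\<close>
  times the exponential, and its integral over an interval reaching beyond the support
  vanishes.\<close>

lemma fourier_L1_deriv:
  assumes d: "\<And>x. (f has_real_derivative f' x) (at x)" and f': "continuous_on UNIV f'"
    and R: "\<And>x. \<bar>x\<bar> > R \<Longrightarrow> f x = 0" "\<And>x. \<bar>x\<bar> > R \<Longrightarrow> f' x = 0"
  shows "fourier_L1 f' \<eta> = 2 * pi * \<i> * \<eta> * fourier_L1 f \<eta>"
proof -
  define e where "e = (\<lambda>x. cis (- (2 * pi * x * \<eta>)))"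
  \<comment> \<open>\<open>R\<close> may be negative; this choice makes the interval from
    \<open>-b\<close> to \<open>b\<close> nondegenerate and places both end points outside the
    support.\<close>
  define b where "b = max R 0 + 1"
  have b: "b > 0" "b > R" by (auto simp: b_def)
  have ce: "continuous_on UNIV e" unfolding e_def by (rule continuous_on_cis_linear)
  have cf: "continuous_on UNIV f"
    using d by (auto intro!: continuous_at_imp_continuous_on DERIV_isCont)
  define G where "G = (\<lambda>x. of_real (f' x) * e x - 2 * pi * \<i> * \<eta> * (of_real (f x) * e x))"
  have de: "(e has_vector_derivative - (2 * pi * \<i> * \<eta>) * e x) (at x)" for x
  proof -
    have "((\<lambda>z. exp (- (2 * pi * \<i> * \<eta>) * z)) has_field_derivative exp (- (2 * pi * \<i> * \<eta>) * of_real x) * (- (2 * pi * \<i> * \<eta>))) (at (of_real x))"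
      by (auto intro!: derivative_eq_intros)
    from has_vector_derivative_real_field[OF this]
    show ?thesis by (simp add: e_def cis_conv_exp o_def mult_ac)
  qed
  have dF: "((\<lambda>x. of_real (f x) * e x) has_vector_derivative G x) (at x within S)" for x S
  proof -
    have "((\<lambda>x. complex_of_real (f x)) has_vector_derivative of_real (f' x)) (at x)"
      using d[of x] by (intro has_vector_derivative_of_real) (simp add: has_real_derivative_iff_has_vector_derivative)
    from has_vector_derivative_mult[OF this de[of x]]
    have "((\<lambda>x. of_real (f x) * e x) has_vector_derivative G x) (at x)"
      by (simp add: G_def algebra_simps)
    then show ?thesis by (rule has_vector_derivative_at_within)
  qed
  have cG: "continuous_on UNIV G"
    unfolding G_def by (intro continuous_intros ce cf f')
  have "(\<integral>x. indicator {-b..b} x *\<^sub>R G x \<partial>lborel) = of_real (f b) * e b - of_real (f (-b)) * e (-b)"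
    using b by (intro integral_FTC_Icc dF continuous_on_subset[OF cG]) auto
  also have "\<dots> = 0" using b R by simp
  also have "(\<lambda>x. indicator {-b..b} x *\<^sub>R G x) = G"
    using R b by (auto simp: fun_eq_iff G_def split: split_indicator)
  finally have "(\<integral>x. G x \<partial>lborel) = 0" .
  moreover have "integrable lborel (\<lambda>x. of_real (f x) * e x)" "integrable lborel (\<lambda>x. of_real (f' x) * e x)"
    using R by (auto intro!: integrable_compact_support[where R=R] continuous_intros cf ce f')
  ultimately show ?thesis
    by (simp add: G_def fourier_L1_def e_def)
qed

lemma DERIV_zero_outside_support:
  fixes f :: "real \<Rightarrow> real"
  assumes "(f has_real_derivative D) (at x)" "\<And>x. \<bar>x\<bar> > R \<Longrightarrow> f x = 0" "\<bar>x\<bar> > R"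
  shows "D = 0"
proof -
  have "open {x::real. \<bar>x\<bar> > R}" by (intro open_Collect_less continuous_intros)
  then have "((\<lambda>_. 0) has_real_derivative D) (at x)"
    using assms by (intro has_field_derivative_transform_within_open[OF assms(1)]) auto
  then show ?thesis using DERIV_const DERIV_unique by blast
qed

text \<open>Each derivative moved onto \<open>f\<close> gains one factor
  \<open>2 * pi * \<eta>\<close>, and in the end the transform is bounded by the integral of the
  modulus. The support does not grow under differentiation, which keeps the induction going.\<close>

lemma fourier_L1_decay:
  assumes "Ck k f" "\<And>x. \<bar>x\<bar> > R \<Longrightarrow> f x = 0"
  shows "\<exists>C. \<forall>\<eta>. \<bar>2 * pi * \<eta>\<bar> ^ k * cmod (fourier_L1 f \<eta>) \<le> C"
  using assms
proof (induction k arbitrary: f)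
  case 0
  then show ?case using fourier_L1_bounded[of f] by auto
next
  case (Suc k)
  then obtain f' where f': "\<And>x. (f has_real_derivative f' x) (at x)" "Ck k f'" by auto
  have s: "f' x = 0" if "\<bar>x\<bar> > R" for x
    using DERIV_zero_outside_support[OF f'(1) Suc.prems(2)] that by blast
  obtain C where C: "\<And>\<eta>. \<bar>2 * pi * \<eta>\<bar> ^ k * cmod (fourier_L1 f' \<eta>) \<le> C"
    using Suc.IH[OF f'(2) s] by auto
  have "fourier_L1 f' \<eta> = 2 * pi * \<i> * \<eta> * fourier_L1 f \<eta>" for \<eta>
    using Suc.prems(2) s by (intro fourier_L1_deriv[OF f'(1) Ck_continuous[OF f'(2)]]) auto
  then have "\<bar>2 * pi * \<eta>\<bar> ^ Suc k * cmod (fourier_L1 f \<eta>) = \<bar>2 * pi * \<eta>\<bar> ^ k * cmod (fourier_L1 f' \<eta>)" for \<eta>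
    by (simp add: norm_mult abs_mult)
  with C show ?case by metis
qed

lemma integrable_inverse_1_plus_square_lborel: "integrable lborel (\<lambda>x::real. inverse (1 + x\<^sup>2))"
  using integrable_inverse_1_plus_square by (simp add: set_integrable_def einterval_def)

lemma fourier_L1_weighted_integrable:
  assumes f: "\<And>k. Ck k f" "\<And>x. \<bar>x\<bar> > R \<Longrightarrow> f x = 0"
  shows "integrable lborel (\<lambda>\<eta>. cmod (fourier_L1 f \<eta>) * weight s \<eta>)"
proof -
  have [measurable]: "f \<in> borel_measurable borel"
    using Ck_continuous[OF f(1)] by (rule borel_measurable_continuous_onI)
  \<comment> \<open>The additional 1 leaves room for a factor \<open>1 + \<eta>\<^sup>2\<close>,
    whose inverse is the integrable majorant.\<close>
  obtain N :: nat where N: "s / 2 + 1 \<le> real N" using real_arch_simple by blast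
  obtain C0 where C0: "\<And>\<eta>. cmod (fourier_L1 f \<eta>) \<le> C0"
    using fourier_L1_bounded by blast
  obtain C where C: "\<And>\<eta>. \<bar>2 * pi * \<eta>\<bar> ^ (2 * N) * cmod (fourier_L1 f \<eta>) \<le> C"
    using fourier_L1_decay[OF f] by blast
  \<comment> \<open>\<open>C0\<close> and \<open>C\<close> are the decay bounds of orders 0 and
    \<open>2 * N\<close>; the power of 2 comes from bounding \<open>1 + \<eta>\<^sup>2\<close> by
    twice the larger of its terms.\<close>
  define B where "B = 2 ^ N * (C0 + C)"
  have "integrable lborel (\<lambda>\<eta>::real. B * inverse (1 + \<eta>\<^sup>2))"
    using integrable_inverse_1_plus_square_lborel by simp
  then show ?thesis
  proof (rule Bochner_Integration.integrable_bound)
    show "AE \<eta> in lborel. norm (cmod (fourier_L1 f \<eta>) * weight s \<eta>) \<le> norm (B * inverse (1 + \<eta>\<^sup>2))"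
    proof (rule AE_I2)
      fix \<eta> :: real
      define a where "a = cmod (fourier_L1 f \<eta>)"
      have a: "a \<ge> 0" by (simp add: a_def)
      have pos: "1 + \<eta>\<^sup>2 > 0" by (simp add: add_pos_nonneg)
      have "weight s \<eta> * (1 + \<eta>\<^sup>2) = (1 + \<eta>\<^sup>2) powr (s / 2 + 1)"
        using pos by (simp add: weight_def powr_add)
      also have "\<dots> \<le> (1 + \<eta>\<^sup>2) powr (real N)" using N by (intro powr_mono) auto
      also have "\<dots> = (1 + \<eta>\<^sup>2) ^ N" using pos by (simp add: powr_realpow)
      also have "\<dots> \<le> (2 * max 1 (\<eta>\<^sup>2)) ^ N" by (intro power_mono) auto
      also have "\<dots> = 2 ^ N * max 1 (\<eta>\<^sup>2) ^ N" by (simp add: power_mult_distrib)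
      also have "max 1 (\<eta>\<^sup>2) ^ N \<le> 1 + \<bar>2 * pi * \<eta>\<bar> ^ (2 * N)"
      proof (cases "\<eta>\<^sup>2 \<le> 1")
        case False
        have "\<bar>\<eta>\<bar> \<le> \<bar>2 * pi * \<eta>\<bar>"
          using pi_gt3 mult_right_mono[of 1 "2 * pi" "\<bar>\<eta>\<bar>"] by (simp add: abs_mult)
        then have "\<bar>\<eta>\<bar> ^ (2 * N) \<le> \<bar>2 * pi * \<eta>\<bar> ^ (2 * N)" by (intro power_mono) auto
        then show ?thesis using False by (simp add: power_mult max_def)
      qed (simp add: max_def)
      finally have "weight s \<eta> * (1 + \<eta>\<^sup>2) \<le> 2 ^ N * (1 + \<bar>2 * pi * \<eta>\<bar> ^ (2 * N))" by simp
      then have "a * (weight s \<eta> * (1 + \<eta>\<^sup>2)) \<le> a * (2 ^ N * (1 + \<bar>2 * pi * \<eta>\<bar> ^ (2 * N)))"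
        using a by (rule mult_left_mono)
      also have "\<dots> = 2 ^ N * (a + \<bar>2 * pi * \<eta>\<bar> ^ (2 * N) * a)" by (simp add: algebra_simps)
      also have "\<dots> \<le> B"
        unfolding B_def a_def by (intro mult_left_mono add_mono C C0) auto
      finally have "a * weight s \<eta> \<le> B * inverse (1 + \<eta>\<^sup>2)"
        using pos by (simp add: field_simps)
      then show "norm (cmod (fourier_L1 f \<eta>) * weight s \<eta>) \<le> norm (B * inverse (1 + \<eta>\<^sup>2))"
        using a unfolding a_def by (simp only: real_norm_def abs_of_nonneg mult_nonneg_nonneg weight_nonneg)
    qed
  qed measurable
qed

section \<open>Gaussian regularisation and Fourier inversion\<close>

text \<open>This is the characteristic function of the standard normal distribution, which supplies
  the Gaussian integral without contour integration.\<close>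

lemma fourier_std_normal_density:
  "(\<integral>z. std_normal_density z *\<^sub>R cis (t * z) \<partial>lborel) = of_real (exp (- (t\<^sup>2) / 2))"
proof -
  have "(\<integral>z. std_normal_density z *\<^sub>R cis (t * z) \<partial>lborel) = (\<integral>z. cis (t * z) \<partial>std_normal_distribution)"
    by (subst integral_density) (auto simp: cis_conv_exp)
  also have "\<dots> = char std_normal_distribution t"
    by (simp add: char_def cis_conv_exp)
  finally show ?thesis by (simp add: char_std_normal_distribution)
qed

lemma fourier_gaussian:
  assumes e: "e > 0"
  shows "(\<integral>\<eta>. of_real (exp (- (e * \<eta>)\<^sup>2 / 2)) * cis (t * \<eta>) \<partial>lborel)
    = of_real (sqrt (2 * pi) / e * exp (- (t / e)\<^sup>2 / 2))"
proof -
  have "(\<integral>\<eta>. of_real (exp (- (e * \<eta>)\<^sup>2 / 2)) * cis (t * \<eta>) \<partial>lborel)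
    = (1 / e) *\<^sub>R (\<integral>z. of_real (exp (- (e * (0 + (1 / e) * z))\<^sup>2 / 2)) * cis (t * (0 + (1 / e) * z)) \<partial>lborel)"
    using e by (subst lborel_integral_real_affine[of "1 / e" _ 0]) auto
  also have "(\<lambda>z. of_real (exp (- (e * (0 + (1 / e) * z))\<^sup>2 / 2)) * cis (t * (0 + (1 / e) * z)))
      = (\<lambda>z. of_real (sqrt (2 * pi)) * (std_normal_density z *\<^sub>R cis ((t / e) * z)))"
    using e by (auto simp: fun_eq_iff std_normal_density_def scaleR_conv_of_real)
  also have "(\<integral>z. of_real (sqrt (2 * pi)) * (std_normal_density z *\<^sub>R cis ((t / e) * z)) \<partial>lborel)
      = of_real (sqrt (2 * pi)) * of_real (exp (- ((t / e)\<^sup>2) / 2))"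
    by (simp only: integral_mult_right_zero fourier_std_normal_density)
  finally show ?thesis by (simp add: scaleR_conv_of_real)
qed

lemma integrable_gaussian:
  assumes "e > 0"
  shows "integrable lborel (\<lambda>\<eta>::real. exp (- (e * \<eta>)\<^sup>2 / 2))"
proof -
  have "integrable lborel (\<lambda>\<eta>. sqrt (2 * pi) * std_normal_density (0 + e * \<eta>))"
    using assms by (intro integrable_mult_right lborel_integrable_real_affine) auto
  then show ?thesis by (simp add: std_normal_density_def)
qed

text \<open>Insert the factor \<open>exp (- (e \<eta>)\<^sup>2 / 2)\<close> and let \<open>e\<close> tend to \<open>0\<close>: by Fubini the regularised integral
  is the mean of \<open>f\<close> against a Gaussian concentrating at \<open>x\<close>.\<close>

theorem fourier_inversion:
  assumes cf: "continuous_on UNIV f" and supp: "\<And>x. \<bar>x\<bar> > R \<Longrightarrow> f x = 0"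
    and K: "integrable lborel (fourier_L1 f)"
  shows "inverse_fourier (fourier_L1 f) x = of_real (f x)"
proof -
  have [measurable]: "f \<in> borel_measurable borel" using cf by (rule borel_measurable_continuous_onI)
  have f: "integrable lborel f" using integrable_compact_support[OF cf supp] .
  define e where "e = (\<lambda>n::nat. 1 / (real n + 1))"
  have e: "e n > 0" for n by (simp add: e_def add_nonneg_pos)
  have elim: "e \<longlonglongrightarrow> 0"
    unfolding e_def using LIMSEQ_inverse_real_of_nat by (simp add: inverse_eq_divide add.commute)
  define A where "A = (\<lambda>n. \<integral>\<eta>. (fourier_L1 f \<eta> * cis (2 * pi * x * \<eta>)) * of_real (exp (- (e n * \<eta>)\<^sup>2 / 2)) \<partial>lborel)"
  have A1: "A \<longlonglongrightarrow> inverse_fourier (fourier_L1 f) x"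
    unfolding A_def inverse_fourier_def
  proof (rule integral_dominated_convergence[where w="\<lambda>\<eta>. cmod (fourier_L1 f \<eta>)"])
    show "AE \<eta> in lborel. (\<lambda>n. fourier_L1 f \<eta> * cis (2 * pi * x * \<eta>) * of_real (exp (- (e n * \<eta>)\<^sup>2 / 2))) \<longlonglongrightarrow> fourier_L1 f \<eta> * cis (2 * pi * x * \<eta>)"
    proof (rule AE_I2)
      fix \<eta>
      have "(\<lambda>n. fourier_L1 f \<eta> * cis (2 * pi * x * \<eta>) * of_real (exp (- (e n * \<eta>)\<^sup>2 / 2))) \<longlonglongrightarrow> fourier_L1 f \<eta> * cis (2 * pi * x * \<eta>) * of_real (exp (- (0 * \<eta>)\<^sup>2 / 2))"
        by (intro tendsto_intros elim) simp
      then show "(\<lambda>n. fourier_L1 f \<eta> * cis (2 * pi * x * \<eta>) * of_real (exp (- (e n * \<eta>)\<^sup>2 / 2))) \<longlonglongrightarrow> fourier_L1 f \<eta> * cis (2 * pi * x * \<eta>)"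
        by simp
    qed
    show "AE \<eta> in lborel. norm (fourier_L1 f \<eta> * cis (2 * pi * x * \<eta>) * of_real (exp (- (e n * \<eta>)\<^sup>2 / 2))) \<le> cmod (fourier_L1 f \<eta>)" for n
      by (auto simp: norm_mult intro!: mult_left_le)
  qed (use K in \<open>auto simp: cis_conv_exp\<close>)
  have A2: "A n = (\<integral>z. of_real (std_normal_density z * f (x + (e n / (2 * pi)) * z)) \<partial>lborel)" for n
  proof -
    \<comment> \<open>Without the Gaussian factor the modulus would not depend on \<eta>, and Fubini
      would fail.\<close>
    define g where "g = (\<lambda>y \<eta>. complex_of_real (f y) * (of_real (exp (- (e n * \<eta>)\<^sup>2 / 2)) * cis ((2 * pi * (x - y)) * \<eta>)))"
    have g: "integrable (lborel \<Otimes>\<^sub>M lborel) (case_prod g)"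
    proof (rule integrable_pair_product_bound)
      show "case_prod g \<in> borel_measurable (lborel \<Otimes>\<^sub>M lborel)"
        unfolding g_def cis_conv_exp by measurable
      show "cmod (g y \<eta>) = \<bar>f y\<bar> * exp (- (e n * \<eta>)\<^sup>2 / 2)" for y \<eta>
        by (simp add: g_def norm_mult)
    qed (use f e in \<open>auto intro!: integrable_gaussian[simplified]\<close>)
    have "A n = (\<integral>\<eta>. (\<integral>y. g y \<eta> \<partial>lborel) \<partial>lborel)"
      unfolding A_def
    proof (rule Bochner_Integration.integral_cong[OF refl])
      fix \<eta>
      have "(\<integral>y. g y \<eta> \<partial>lborel) = (\<integral>y. (of_real (f y) * cis (- (2 * pi * y * \<eta>))) * (cis (2 * pi * x * \<eta>) * of_real (exp (- (e n * \<eta>)\<^sup>2 / 2))) \<partial>lborel)"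
      proof (rule Bochner_Integration.integral_cong[OF refl])
        fix y
        have "cis ((2 * pi * (x - y)) * \<eta>) = cis (- (2 * pi * y * \<eta>)) * cis (2 * pi * x * \<eta>)"
          by (simp add: cis_mult algebra_simps)
        then show "g y \<eta> = (of_real (f y) * cis (- (2 * pi * y * \<eta>))) * (cis (2 * pi * x * \<eta>) * of_real (exp (- (e n * \<eta>)\<^sup>2 / 2)))"
          by (simp add: g_def)
      qed
      also have "\<dots> = fourier_L1 f \<eta> * (cis (2 * pi * x * \<eta>) * of_real (exp (- (e n * \<eta>)\<^sup>2 / 2)))"
        by (simp only: integral_mult_left_zero fourier_L1_def)
      finally show "fourier_L1 f \<eta> * cis (2 * pi * x * \<eta>) * of_real (exp (- (e n * \<eta>)\<^sup>2 / 2)) = (\<integral>y. g y \<eta> \<partial>lborel)"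
        by simp
    qed
    also have "\<dots> = (\<integral>y. (\<integral>\<eta>. g y \<eta> \<partial>lborel) \<partial>lborel)"
      by (rule lborel_pair.Fubini_integral[OF g])
    also have "\<dots> = (\<integral>y. of_real (f y * (sqrt (2 * pi) / e n * exp (- ((2 * pi * (x - y)) / e n)\<^sup>2 / 2))) \<partial>lborel)"
      unfolding g_def by (simp only: integral_mult_right_zero fourier_gaussian[OF e] of_real_mult)
    \<comment> \<open>Substitutes \<open>y = x + (e n / (2 * pi)) * z\<close>, the scale at which
      the Gaussian becomes standard; the constants combine to its normalisation.\<close>
    also have "\<dots> = \<bar>e n / (2 * pi)\<bar> *\<^sub>R (\<integral>z. of_real (f (x + (e n / (2 * pi)) * z) * (sqrt (2 * pi) / e n * exp (- ((2 * pi * (x - (x + (e n / (2 * pi)) * z))) / e n)\<^sup>2 / 2))) \<partial>lborel)"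
      using e[of n] by (intro lborel_integral_real_affine) simp
    also have "\<dots> = (\<integral>z. \<bar>e n / (2 * pi)\<bar> *\<^sub>R of_real (f (x + (e n / (2 * pi)) * z) * (sqrt (2 * pi) / e n * exp (- ((2 * pi * (x - (x + (e n / (2 * pi)) * z))) / e n)\<^sup>2 / 2))) \<partial>lborel)"
      by (simp only: integral_scaleR_right)
    also have "\<dots> = (\<integral>z. of_real (std_normal_density z * f (x + (e n / (2 * pi)) * z)) \<partial>lborel)"
    proof (rule Bochner_Integration.integral_cong[OF refl])
      fix z
      have 1: "(2 * pi * (x - (x + (e n / (2 * pi)) * z))) / e n = - z"
        using e[of n] by (simp add: field_simps)
      have 2: "\<bar>e n / (2 * pi)\<bar> * (sqrt (2 * pi) / e n) = 1 / sqrt (2 * pi)"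
      proof -
        have "sqrt (2 * pi) * sqrt (2 * pi) = 2 * pi" by simp
        then show ?thesis using e[of n] by (simp add: field_simps)
      qed
      have "\<bar>e n / (2 * pi)\<bar> * (f (x + (e n / (2 * pi)) * z) * (sqrt (2 * pi) / e n * exp (- ((2 * pi * (x - (x + (e n / (2 * pi)) * z))) / e n)\<^sup>2 / 2)))
          = (\<bar>e n / (2 * pi)\<bar> * (sqrt (2 * pi) / e n)) * exp (- (- z)\<^sup>2 / 2) * f (x + (e n / (2 * pi)) * z)"
        unfolding 1 by (simp only: mult_ac)
      also have "\<dots> = std_normal_density z * f (x + (e n / (2 * pi)) * z)"
        unfolding 2 by (simp add: std_normal_density_def)
      finally show "\<bar>e n / (2 * pi)\<bar> *\<^sub>R complex_of_real (f (x + (e n / (2 * pi)) * z) * (sqrt (2 * pi) / e n * exp (- ((2 * pi * (x - (x + (e n / (2 * pi)) * z))) / e n)\<^sup>2 / 2)))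
          = of_real (std_normal_density z * f (x + (e n / (2 * pi)) * z))"
        unfolding scaleR_conv_of_real of_real_mult[symmetric] by simp
    qed
    finally show ?thesis .
  qed
  obtain B where B: "\<And>y. \<bar>f y\<bar> \<le> B"
  proof -
    have "compact (f ` {-R..R})"
      by (intro compact_continuous_image continuous_on_subset[OF cf]) auto
    then obtain B where B: "\<And>y. y \<in> {-R..R} \<Longrightarrow> \<bar>f y\<bar> \<le> B"
      by (metis compact_imp_bounded bounded_real imageI)
    \<comment> \<open>The maximum with 0 covers the points outside the interval, where
      \<open>f\<close> vanishes, also when the interval is empty and \<open>B\<close> is
      arbitrary.\<close>
    have "\<bar>f y\<bar> \<le> max B 0" for y
      using B[of y] supp[of y] by (cases "\<bar>y\<bar> > R") (auto simp: le_max_iff_disj abs_le_iff not_less)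
    then show ?thesis using that by blast
  qed
  have "(\<lambda>n. \<integral>z. complex_of_real (std_normal_density z * f (x + (e n / (2 * pi)) * z)) \<partial>lborel) \<longlonglongrightarrow> (\<integral>z. complex_of_real (std_normal_density z * f x) \<partial>lborel)"
  proof (rule integral_dominated_convergence[where w="\<lambda>z. std_normal_density z * B"])
    show "AE z in lborel. (\<lambda>n. complex_of_real (std_normal_density z * f (x + (e n / (2 * pi)) * z))) \<longlonglongrightarrow> complex_of_real (std_normal_density z * f x)"
    proof (rule AE_I2)
      fix z
      have "(\<lambda>n. x + (e n / (2 * pi)) * z) \<longlonglongrightarrow> x + (0 / (2 * pi)) * z"
        by (intro tendsto_intros elim) simp
      then have "(\<lambda>n. f (x + (e n / (2 * pi)) * z)) \<longlonglongrightarrow> f x"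
        using cf by (intro isCont_tendsto_compose[of x f]) (auto simp: continuous_on_eq_continuous_at)
      then show "(\<lambda>n. complex_of_real (std_normal_density z * f (x + (e n / (2 * pi)) * z))) \<longlonglongrightarrow> complex_of_real (std_normal_density z * f x)"
        by (intro tendsto_of_real tendsto_mult tendsto_const)
    qed
    show "AE z in lborel. norm (complex_of_real (std_normal_density z * f (x + (e n / (2 * pi)) * z))) \<le> std_normal_density z * B" for n
      using B by (auto simp: norm_mult normal_density_nonneg intro!: mult_left_mono)
  qed auto
  also have "(\<integral>z. complex_of_real (std_normal_density z * f x) \<partial>lborel) = of_real (f x)"
    by (simp only: integral_complex_of_real) simp
  finally have "A \<longlonglongrightarrow> of_real (f x)" unfolding A2[abs_def] .
  with A1 show ?thesis by (rule LIMSEQ_unique)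
qed

section \<open>Dilated cutoffs and the pairing\<close>

lemma wenergy_cmult:
  assumes [measurable]: "F \<in> borel_measurable borel"
  shows "wenergy s (\<lambda>\<xi>. a * F \<xi>) = ennreal ((cmod a)\<^sup>2) * wenergy s F"
proof -
  have "wenergy s (\<lambda>\<xi>. a * F \<xi>) = (\<integral>\<^sup>+\<xi>. ennreal ((cmod a)\<^sup>2) * ennreal (weight s \<xi> * (cmod (F \<xi>))\<^sup>2) \<partial>lborel)"
    unfolding wenergy_def
    by (intro nn_integral_cong) (simp add: norm_mult power_mult_distrib mult_ac flip: ennreal_mult)
  also have "\<dots> = ennreal ((cmod a)\<^sup>2) * wenergy s F"
    unfolding wenergy_def by (rule nn_integral_cmult) simp
  finally show ?thesis .
qed

lemma wenergy_diff_le: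
  assumes [measurable]: "F \<in> borel_measurable borel" "G \<in> borel_measurable borel"
  shows "wenergy s (\<lambda>\<xi>. F \<xi> - G \<xi>) \<le> 2 * wenergy s F + 2 * wenergy s G"
  using wenergy_add_le[of F "\<lambda>\<xi>. - G \<xi>" s] by (simp add: wenergy_def)

lemma wenergy_minus_commute: "wenergy s (\<lambda>\<xi>. F \<xi> - G \<xi>) = wenergy s (\<lambda>\<xi>. G \<xi> - F \<xi>)"
  by (simp add: wenergy_def norm_minus_commute)

text \<open>The combination has the shape in which a cutoff arises: a constant times
  \<open>u\<close> minus the compactly supported part times \<open>u\<close>.\<close>

lemma fourier_L2_diff:
  assumes "fourier_L2 u U" "fourier_L2 v V"
  shows "fourier_L2 (\<lambda>x. a * u x - v x) (\<lambda>\<xi>. a * U \<xi> - V \<xi>)"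
proof -
  have L: "L2 u" "L2 U" "L2 v" "L2 V"
    and lim: "(\<lambda>n. wenergy 0 (\<lambda>\<xi>. trunc_fourier u n \<xi> - U \<xi>)) \<longlonglongrightarrow> 0"
      "(\<lambda>n. wenergy 0 (\<lambda>\<xi>. trunc_fourier v n \<xi> - V \<xi>)) \<longlonglongrightarrow> 0"
    using assms by (auto simp: fourier_L2_iff)
  have [measurable]: "u \<in> borel_measurable borel" "U \<in> borel_measurable borel"
    "v \<in> borel_measurable borel" "V \<in> borel_measurable borel"
    using L by (auto simp: L2_iff)
  have L2_diff: "L2 (\<lambda>x. a * p x - q x)" if "L2 p" "L2 q" for p q
  proof -
    have [measurable]: "p \<in> borel_measurable borel" "q \<in> borel_measurable borel"
      using that by (auto simp: L2_iff)
    have "wenergy 0 (\<lambda>x. a * p x - q x) \<le> 2 * wenergy 0 (\<lambda>x. a * p x) + 2 * wenergy 0 q"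
      by (rule wenergy_diff_le) measurable
    also have "\<dots> < \<infinity>"
      using that by (auto simp: L2_iff wenergy_cmult ennreal_mult_less_top)
    finally show ?thesis by (simp add: L2_iff)
  qed
  have "(\<lambda>n. 2 * (ennreal ((cmod a)\<^sup>2) * wenergy 0 (\<lambda>\<xi>. trunc_fourier u n \<xi> - U \<xi>)) + 2 * wenergy 0 (\<lambda>\<xi>. trunc_fourier v n \<xi> - V \<xi>)) \<longlonglongrightarrow> 0"
    by (intro ennreal_tendsto_0_add ennreal_tendsto_0_cmult lim) auto
  then have "(\<lambda>n. wenergy 0 (\<lambda>\<xi>. trunc_fourier (\<lambda>x. a * u x - v x) n \<xi> - (a * U \<xi> - V \<xi>))) \<longlonglongrightarrow> 0"
  proof (rule ennreal_tendsto_0_le)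
    fix n
    have "wenergy 0 (\<lambda>\<xi>. trunc_fourier (\<lambda>x. a * u x - v x) n \<xi> - (a * U \<xi> - V \<xi>))
      = wenergy 0 (\<lambda>\<xi>. a * (trunc_fourier u n \<xi> - U \<xi>) - (trunc_fourier v n \<xi> - V \<xi>))"
      by (simp add: trunc_fourier_diff L algebra_simps)
    also have "\<dots> \<le> 2 * wenergy 0 (\<lambda>\<xi>. a * (trunc_fourier u n \<xi> - U \<xi>)) + 2 * wenergy 0 (\<lambda>\<xi>. trunc_fourier v n \<xi> - V \<xi>)"
      by (rule wenergy_diff_le) measurable
    also have "wenergy 0 (\<lambda>\<xi>. a * (trunc_fourier u n \<xi> - U \<xi>)) = ennreal ((cmod a)\<^sup>2) * wenergy 0 (\<lambda>\<xi>. trunc_fourier u n \<xi> - U \<xi>)"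
      by (rule wenergy_cmult) measurable
    finally show "wenergy 0 (\<lambda>\<xi>. trunc_fourier (\<lambda>x. a * u x - v x) n \<xi> - (a * U \<xi> - V \<xi>))
      \<le> 2 * (ennreal ((cmod a)\<^sup>2) * wenergy 0 (\<lambda>\<xi>. trunc_fourier u n \<xi> - U \<xi>)) + 2 * wenergy 0 (\<lambda>\<xi>. trunc_fourier v n \<xi> - V \<xi>)" .
  qed
  then show ?thesis unfolding fourier_L2_iff using L L2_diff by blast
qed

text \<open>Both functions are limits of the same truncations, so the energy of their difference is
  a constant bounded by a null sequence.\<close>

lemma fourier_L2_unique:
  assumes "fourier_L2 u U" "fourier_L2 u V"
  shows "AE \<xi> in lborel. U \<xi> = V \<xi>"
proof -
  have L: "L2 u" "L2 U" "L2 V"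
    and lim: "(\<lambda>n. wenergy 0 (\<lambda>\<xi>. trunc_fourier u n \<xi> - U \<xi>)) \<longlonglongrightarrow> 0"
      "(\<lambda>n. wenergy 0 (\<lambda>\<xi>. trunc_fourier u n \<xi> - V \<xi>)) \<longlonglongrightarrow> 0"
    using assms by (auto simp: fourier_L2_iff)
  have [measurable]: "u \<in> borel_measurable borel" "U \<in> borel_measurable borel" "V \<in> borel_measurable borel"
    using L by (auto simp: L2_iff)
  have "(\<lambda>n. 2 * wenergy 0 (\<lambda>\<xi>. trunc_fourier u n \<xi> - V \<xi>) + 2 * wenergy 0 (\<lambda>\<xi>. trunc_fourier u n \<xi> - U \<xi>)) \<longlonglongrightarrow> 0"
    by (intro ennreal_tendsto_0_add ennreal_tendsto_0_cmult lim) auto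
  moreover have "wenergy 0 (\<lambda>\<xi>. U \<xi> - V \<xi>) \<le> 2 * wenergy 0 (\<lambda>\<xi>. trunc_fourier u n \<xi> - V \<xi>) + 2 * wenergy 0 (\<lambda>\<xi>. trunc_fourier u n \<xi> - U \<xi>)" for n
    using wenergy_diff_le[of "\<lambda>\<xi>. trunc_fourier u n \<xi> - V \<xi>" "\<lambda>\<xi>. trunc_fourier u n \<xi> - U \<xi>" 0] by simp
  ultimately have "(\<lambda>n::nat. wenergy 0 (\<lambda>\<xi>. U \<xi> - V \<xi>)) \<longlonglongrightarrow> 0"
    by (rule ennreal_tendsto_0_le)
  then have "wenergy 0 (\<lambda>\<xi>. U \<xi> - V \<xi>) = 0"
    by (simp add: LIMSEQ_const_iff)
  then show ?thesis
    unfolding wenergy_0 by (subst (asm) nn_integral_0_iff_AE) auto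
qed

text \<open>The choice in \<open>fourier\<close> has the intended property as soon as one transform
  \<open>U\<close> is at hand; the convolution formula supplies it for the cutoffs and the Sobolev
  hypothesis for \<open>u\<close>.\<close>

lemma fourier_works: "fourier_L2 u U \<Longrightarrow> fourier_L2 u (fourier u)"
  unfolding fourier_def by (rule someI[where P="fourier_L2 u"])

lemma fourier_measurable: "fourier_L2 u U \<Longrightarrow> fourier u \<in> borel_measurable borel"
  using fourier_works by (auto simp: fourier_L2_iff L2_iff)

lemma fourier_AE_eq: "fourier_L2 u U \<Longrightarrow> AE \<xi> in lborel. fourier u \<xi> = U \<xi>"
  using fourier_L2_unique fourier_works by blast

lemma wenergy_fourier_diff:
  assumes "fourier_L2 u U"
  shows "wenergy s (\<lambda>\<xi>. fourier u \<xi> - V \<xi>) = wenergy s (\<lambda>\<xi>. U \<xi> - V \<xi>)"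
  using fourier_AE_eq[OF assms] by (intro wenergy_cong_AE) auto

theorem fourier_cutoff_tendsto:
  fixes f :: "real \<Rightarrow> real"
  assumes f: "\<And>k. Ck k f" "\<And>x. \<bar>x\<bar> > R \<Longrightarrow> f x = c"
    and u: "fourier_L2 u U" "wenergy s U < \<infinity>" "s \<ge> 0" and h: "h \<longlonglongrightarrow> 0"
  defines "v \<equiv> \<lambda>n x. of_real (f (h n * x)) * u x"
  shows "fourier_L2 (v n) (fourier (v n))"
    and "(\<lambda>n. wenergy s (\<lambda>\<xi>. fourier (v n) \<xi> - of_real (f 0) * U \<xi>)) \<longlonglongrightarrow> 0"
proof -
  define g where "g = (\<lambda>x. c + (-1) * f x)"
  have g: "Ck k g" for k unfolding g_def by (intro Ck_add Ck_mult Ck_const f)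
  have supp: "g x = 0" if "\<bar>x\<bar> > R" for x using f(2)[OF that] by (simp add: g_def)
  define K where "K = fourier_L1 g"
  have [measurable]: "g \<in> borel_measurable borel"
    using Ck_continuous[OF g] by (rule borel_measurable_continuous_onI)
  have [measurable]: "K \<in> borel_measurable borel" unfolding K_def by measurable
  have Kw: "integrable lborel (\<lambda>\<eta>. cmod (K \<eta>) * weight t \<eta>)" for t
    unfolding K_def using g supp by (rule fourier_L1_weighted_integrable)
  have K: "integrable lborel K"
    using Kw[of 0] by (intro integrable_norm_cancel[of _ K]) auto
  have inv: "inverse_fourier K x = of_real (g x)" for x
    unfolding K_def using Ck_continuous[OF g] supp K[unfolded K_def] by (rule fourier_inversion)
  \<comment> \<open>Inversion at the origin, where every \<open>cis\<close> factor is 1. It turns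
    the limiting multiplier \<open>c\<close> minus the mass of \<open>K\<close> into
    \<open>f 0\<close>.\<close>
  have int_K: "(\<integral>\<eta>. K \<eta> \<partial>lborel) = of_real (g 0)"
    using inv[of 0] by (simp add: inverse_fourier_def)
  have [measurable]: "U \<in> borel_measurable borel"
    using u by (auto simp: fourier_L2_iff L2_iff)
  have F: "fourier_L2 (v n) (\<lambda>\<xi>. of_real c * U \<xi> - dilated_conv K (h n) U \<xi>)" for n
  proof -
    have "v n = (\<lambda>x. of_real c * u x - inverse_fourier K (h n * x) * u x)"
      unfolding inv v_def g_def by (simp add: fun_eq_iff algebra_simps)
    then show ?thesis
      using fourier_L2_diff[OF u(1) fourier_L2_inverse_fourier_mult[OF K u(1), of "h n"], of "of_real c"] by simp
  qed
  show "fourier_L2 (v n) (fourier (v n))" using F by (rule fourier_works)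
  have "wenergy s (\<lambda>\<xi>. fourier (v n) \<xi> - of_real (f 0) * U \<xi>) = wenergy s (\<lambda>\<xi>. dilated_conv K (h n) U \<xi> - (\<integral>\<eta>. K \<eta> \<partial>lborel) * U \<xi>)" for n
  proof -
    have "wenergy s (\<lambda>\<xi>. fourier (v n) \<xi> - of_real (f 0) * U \<xi>)
        = wenergy s (\<lambda>\<xi>. (of_real c * U \<xi> - dilated_conv K (h n) U \<xi>) - of_real (f 0) * U \<xi>)"
      by (rule wenergy_fourier_diff[OF F])
    also have "\<dots> = wenergy s (\<lambda>\<xi>. (\<integral>\<eta>. K \<eta> \<partial>lborel) * U \<xi> - dilated_conv K (h n) U \<xi>)"
      unfolding int_K g_def by (simp add: algebra_simps)
    also have "\<dots> = wenergy s (\<lambda>\<xi>. dilated_conv K (h n) U \<xi> - (\<integral>\<eta>. K \<eta> \<partial>lborel) * U \<xi>)"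
      by (rule wenergy_minus_commute)
    finally show ?thesis .
  qed
  then show "(\<lambda>n. wenergy s (\<lambda>\<xi>. fourier (v n) \<xi> - of_real (f 0) * U \<xi>)) \<longlonglongrightarrow> 0"
    using dilated_conv_tendsto[OF K Kw _ u(2,3) h] by simp
qed

section \<open>Continuity of the sesquilinear form of the multiplier\<close>

text \<open>Cauchy-Schwarz, with one square root of the weight given to each argument. The squared
  form is used so that both energies appear without roots.\<close>

lemma multiplier_form_bound:
  fixes m :: "real \<Rightarrow> real"
  assumes [measurable]: "m \<in> borel_measurable borel" "P \<in> borel_measurable borel" "Q \<in> borel_measurable borel"
    and m: "\<And>\<xi>. \<bar>m \<xi>\<bar> \<le> A * weight s \<xi>" and A: "A \<ge> 0"
  shows "(\<integral>\<^sup>+\<xi>. cmod (cnj (P \<xi>) * of_real (m \<xi>) * Q \<xi>) \<partial>lborel)\<^sup>2 \<le> ennreal (A\<^sup>2) * (wenergy s P * wenergy s Q)"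
proof -
  have "(\<integral>\<^sup>+\<xi>. cmod (cnj (P \<xi>) * of_real (m \<xi>) * Q \<xi>) \<partial>lborel)
      \<le> (\<integral>\<^sup>+\<xi>. ennreal (A * (sqrt (weight s \<xi>) * cmod (P \<xi>))) * ennreal (sqrt (weight s \<xi>) * cmod (Q \<xi>)) \<partial>lborel)"
  proof (intro nn_integral_mono)
    fix \<xi>
    have "cmod (cnj (P \<xi>) * of_real (m \<xi>) * Q \<xi>) = cmod (P \<xi>) * \<bar>m \<xi>\<bar> * cmod (Q \<xi>)"
      by (simp add: norm_mult)
    also have "\<dots> \<le> cmod (P \<xi>) * (A * weight s \<xi>) * cmod (Q \<xi>)"
      by (intro mult_right_mono mult_left_mono m) auto
    also have "\<dots> = cmod (P \<xi>) * (A * (sqrt (weight s \<xi>) * sqrt (weight s \<xi>))) * cmod (Q \<xi>)"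
      by simp
    also have "\<dots> = (A * (sqrt (weight s \<xi>) * cmod (P \<xi>))) * (sqrt (weight s \<xi>) * cmod (Q \<xi>))"
      by (simp only: mult_ac)
    finally show "ennreal (cmod (cnj (P \<xi>) * of_real (m \<xi>) * Q \<xi>)) \<le> ennreal (A * (sqrt (weight s \<xi>) * cmod (P \<xi>))) * ennreal (sqrt (weight s \<xi>) * cmod (Q \<xi>))"
      using A by (subst ennreal_mult[symmetric]) (auto intro: ennreal_leI)
  qed
  then have "(\<integral>\<^sup>+\<xi>. cmod (cnj (P \<xi>) * of_real (m \<xi>) * Q \<xi>) \<partial>lborel)\<^sup>2
      \<le> (\<integral>\<^sup>+\<xi>. ennreal (A * (sqrt (weight s \<xi>) * cmod (P \<xi>))) * ennreal (sqrt (weight s \<xi>) * cmod (Q \<xi>)) \<partial>lborel)\<^sup>2"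
    by (rule power_mono) simp
  also have "\<dots> \<le> (\<integral>\<^sup>+\<xi>. (ennreal (A * (sqrt (weight s \<xi>) * cmod (P \<xi>))))\<^sup>2 \<partial>lborel) * (\<integral>\<^sup>+\<xi>. (ennreal (sqrt (weight s \<xi>) * cmod (Q \<xi>)))\<^sup>2 \<partial>lborel)"
    by (rule Cauchy_Schwarz_nn_integral) measurable
  also have "(\<integral>\<^sup>+\<xi>. (ennreal (sqrt (weight s \<xi>) * cmod (Q \<xi>)))\<^sup>2 \<partial>lborel) = wenergy s Q"
    unfolding wenergy_def by (intro nn_integral_cong) (simp add: ennreal_power power_mult_distrib)
  also have "(\<integral>\<^sup>+\<xi>. (ennreal (A * (sqrt (weight s \<xi>) * cmod (P \<xi>))))\<^sup>2 \<partial>lborel) = (\<integral>\<^sup>+\<xi>. ennreal (A\<^sup>2) * ennreal (weight s \<xi> * (cmod (P \<xi>))\<^sup>2) \<partial>lborel)"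
    using A by (intro nn_integral_cong) (simp add: ennreal_power power_mult_distrib flip: ennreal_mult)
  also have "\<dots> = ennreal (A\<^sup>2) * wenergy s P"
    unfolding wenergy_def by (rule nn_integral_cmult) measurable
  finally show ?thesis by (simp add: mult.assoc)
qed

lemma multiplier_form_integrable:
  fixes m :: "real \<Rightarrow> real"
  assumes [measurable]: "m \<in> borel_measurable borel" "P \<in> borel_measurable borel" "Q \<in> borel_measurable borel"
    and m: "\<And>\<xi>. \<bar>m \<xi>\<bar> \<le> A * weight s \<xi>" and A: "A \<ge> 0"
    and fin: "wenergy s P < \<infinity>" "wenergy s Q < \<infinity>"
  shows "integrable lborel (\<lambda>\<xi>. cnj (P \<xi>) * of_real (m \<xi>) * Q \<xi>)"
proof -
  have "(\<integral>\<^sup>+\<xi>. cmod (cnj (P \<xi>) * of_real (m \<xi>) * Q \<xi>) \<partial>lborel)\<^sup>2 < \<infinity>"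
    by (rule le_less_trans[OF multiplier_form_bound[where A=A and s=s]])
       (use m A fin in \<open>auto simp: ennreal_mult_less_top\<close>)
  then have "(\<integral>\<^sup>+\<xi>. cmod (cnj (P \<xi>) * of_real (m \<xi>) * Q \<xi>) \<partial>lborel) < \<infinity>"
    by (auto simp: power_less_top_ennreal)
  moreover have [measurable]: "cnj \<in> borel_measurable borel"
    by (intro borel_measurable_continuous_onI continuous_intros)
  ultimately show ?thesis unfolding integrable_iff_bounded by simp
qed

lemma multiplier_form_tendsto_0:
  fixes m :: "real \<Rightarrow> real"
  assumes [measurable]: "m \<in> borel_measurable borel" "\<And>n. P n \<in> borel_measurable borel" "\<And>n. Q n \<in> borel_measurable borel"
    and m: "\<And>\<xi>. \<bar>m \<xi>\<bar> \<le> A * weight s \<xi>" and A: "A \<ge> 0"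
    and lim: "(\<lambda>n. wenergy s (P n) * wenergy s (Q n)) \<longlonglongrightarrow> 0"
  shows "(\<lambda>n. \<integral>\<xi>. cnj (P n \<xi>) * of_real (m \<xi>) * Q n \<xi> \<partial>lborel) \<longlonglongrightarrow> 0"
proof -
  let ?B = "\<lambda>n. \<integral>\<xi>. cnj (P n \<xi>) * of_real (m \<xi>) * Q n \<xi> \<partial>lborel"
  have "(\<lambda>n. ennreal (A\<^sup>2) * (wenergy s (P n) * wenergy s (Q n))) \<longlonglongrightarrow> 0"
    using lim by (rule ennreal_tendsto_0_cmult) simp
  then have "(\<lambda>n. ennreal ((cmod (?B n))\<^sup>2)) \<longlonglongrightarrow> 0"
  proof (rule ennreal_tendsto_0_le)
    fix n
    have "ennreal (cmod (?B n)) \<le> (\<integral>\<^sup>+\<xi>. cmod (cnj (P n \<xi>) * of_real (m \<xi>) * Q n \<xi>) \<partial>lborel)"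
      using integral_norm_bound_ennreal[of lborel "\<lambda>\<xi>. cnj (P n \<xi>) * of_real (m \<xi>) * Q n \<xi>"]
      by (cases "integrable lborel (\<lambda>\<xi>. cnj (P n \<xi>) * of_real (m \<xi>) * Q n \<xi>)") (auto simp: not_integrable_integral_eq)
    then have "(ennreal (cmod (?B n)))\<^sup>2 \<le> (\<integral>\<^sup>+\<xi>. cmod (cnj (P n \<xi>) * of_real (m \<xi>) * Q n \<xi>) \<partial>lborel)\<^sup>2"
      by (rule power_mono) simp
    also have "\<dots> \<le> ennreal (A\<^sup>2) * (wenergy s (P n) * wenergy s (Q n))"
      by (rule multiplier_form_bound) (use m A in auto)
    finally show "ennreal ((cmod (?B n))\<^sup>2) \<le> ennreal (A\<^sup>2) * (wenergy s (P n) * wenergy s (Q n))"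
      by (simp add: ennreal_power)
  qed
  then have "(\<lambda>n. (cmod (?B n))\<^sup>2) \<longlonglongrightarrow> 0"
    by (simp flip: ennreal_0)
  then have "(\<lambda>n. cmod (?B n)) \<longlonglongrightarrow> 0"
    using tendsto_real_sqrt[of "\<lambda>n. (cmod (?B n))\<^sup>2" 0] by simp
  then show ?thesis by (rule tendsto_norm_zero_cancel)
qed

text \<open>Expands the form around \<open>V\<close> and \<open>W\<close>; each of the three
  remaining terms contains at least one increment of vanishing energy. Finite energy of
  \<open>V\<close> and \<open>W\<close> excludes the product of 0 and infinity. The increments may
  have infinite energy for small \<open>n\<close>, so the expansion is claimed only
  eventually.\<close>

theorem multiplier_form_tendsto:
  fixes m :: "real \<Rightarrow> real"
  assumes [measurable]: "m \<in> borel_measurable borel" "\<And>n. F n \<in> borel_measurable borel" "\<And>n. G n \<in> borel_measurable borel"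
      "V \<in> borel_measurable borel" "W \<in> borel_measurable borel"
    and m: "\<And>\<xi>. \<bar>m \<xi>\<bar> \<le> A * weight s \<xi>" and A: "A \<ge> 0"
    and fin: "wenergy s V < \<infinity>" "wenergy s W < \<infinity>"
    and lim: "(\<lambda>n. wenergy s (\<lambda>\<xi>. F n \<xi> - V \<xi>)) \<longlonglongrightarrow> 0" "(\<lambda>n. wenergy s (\<lambda>\<xi>. G n \<xi> - W \<xi>)) \<longlonglongrightarrow> 0"
  shows "(\<lambda>n. \<integral>\<xi>. cnj (F n \<xi>) * of_real (m \<xi>) * G n \<xi> \<partial>lborel) \<longlonglongrightarrow> (\<integral>\<xi>. cnj (V \<xi>) * of_real (m \<xi>) * W \<xi> \<partial>lborel)"
proof -
  define B where "B = (\<lambda>P Q. \<integral>\<xi>. cnj (P \<xi>) * of_real (m \<xi>) * Q \<xi> \<partial>lborel)"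
  define a where "a = (\<lambda>n \<xi>. F n \<xi> - V \<xi>)"
  define b where "b = (\<lambda>n \<xi>. G n \<xi> - W \<xi>)"
  have [measurable]: "a n \<in> borel_measurable borel" "b n \<in> borel_measurable borel" for n
    unfolding a_def b_def by measurable
  have al: "(\<lambda>n. wenergy s (a n)) \<longlonglongrightarrow> 0" and bl: "(\<lambda>n. wenergy s (b n)) \<longlonglongrightarrow> 0"
    using lim by (auto simp: a_def b_def)
  have "(\<lambda>n. wenergy s (a n) * wenergy s W) \<longlonglongrightarrow> 0 * wenergy s W"
    "(\<lambda>n. wenergy s V * wenergy s (b n)) \<longlonglongrightarrow> wenergy s V * 0"
    "(\<lambda>n. wenergy s (a n) * wenergy s (b n)) \<longlonglongrightarrow> 0 * 0"
    using fin by (intro tendsto_mult_ennreal al bl tendsto_const; auto)+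
  then have "(\<lambda>n. B (a n) W) \<longlonglongrightarrow> 0" "(\<lambda>n. B V (b n)) \<longlonglongrightarrow> 0" "(\<lambda>n. B (a n) (b n)) \<longlonglongrightarrow> 0"
    unfolding B_def by (intro multiplier_form_tendsto_0[OF _ _ _ m A]; simp)+
  then have "(\<lambda>n. B V W + (B (a n) W + B V (b n) + B (a n) (b n))) \<longlonglongrightarrow> B V W + (0 + 0 + 0)"
    by (intro tendsto_intros)
  moreover have "eventually (\<lambda>n. B V W + (B (a n) W + B V (b n) + B (a n) (b n)) = B (F n) (G n)) sequentially"
  proof -
    have "eventually (\<lambda>n. wenergy s (a n) < \<infinity>) sequentially" "eventually (\<lambda>n. wenergy s (b n) < \<infinity>) sequentially"
      using order_tendstoD(2)[OF al, of \<infinity>] order_tendstoD(2)[OF bl, of \<infinity>] by auto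
    then show ?thesis
    proof eventually_elim
      case (elim n)
      have i: "integrable lborel (\<lambda>\<xi>. cnj (V \<xi>) * of_real (m \<xi>) * W \<xi>)"
        "integrable lborel (\<lambda>\<xi>. cnj (a n \<xi>) * of_real (m \<xi>) * W \<xi>)"
        "integrable lborel (\<lambda>\<xi>. cnj (V \<xi>) * of_real (m \<xi>) * b n \<xi>)"
        "integrable lborel (\<lambda>\<xi>. cnj (a n \<xi>) * of_real (m \<xi>) * b n \<xi>)"
        by (intro multiplier_form_integrable[OF _ _ _ m A] fin elim; simp)+
      have *: "cnj (F n \<xi>) * of_real (m \<xi>) * G n \<xi> = cnj (V \<xi>) * of_real (m \<xi>) * W \<xi>
          + (cnj (a n \<xi>) * of_real (m \<xi>) * W \<xi> + cnj (V \<xi>) * of_real (m \<xi>) * b n \<xi> + cnj (a n \<xi>) * of_real (m \<xi>) * b n \<xi>)" for \<xi>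
        by (simp add: a_def b_def algebra_simps)
      show ?case
        unfolding B_def * using i by simp
    qed
  qed
  ultimately have "(\<lambda>n. B (F n) (G n)) \<longlonglongrightarrow> B V W"
    by (simp add: tendsto_cong)
  then show ?thesis by (simp add: B_def)
qed

lemma piecewise_cont_measurable:
  assumes "piecewise_cont m"
  shows "m \<in> borel_measurable borel"
proof -
  obtain D where "finite D" "\<And>x. x \<notin> D \<Longrightarrow> isCont m x"
    using assms unfolding piecewise_cont_def by blast
  then show ?thesis
    by (intro borel_measurable_continuous_countable_exceptions[of D])
       (auto simp: countable_finite intro!: continuous_at_imp_continuous_on)
qed

text \<open>For small frequencies the weight is at least 1. For large ones the power
  \<open>s\<close> of the modulus is the power \<open>s / 2\<close> of the square, and the lower
  bound in the assumption makes \<open>m\<close> nonnegative, so that its absolute value is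
  controlled as well.\<close>

lemma assumptionA_bound:
  assumes "assumptionA s m"
  obtains A where "A \<ge> 0" "\<And>\<xi>. \<bar>m \<xi>\<bar> \<le> A * weight s \<xi>"
proof -
  obtain A1 A where A: "A1 > 0" "A > 0"
    and big: "\<And>\<xi>. \<bar>\<xi>\<bar> \<ge> 1 \<Longrightarrow> A1 * \<bar>\<xi>\<bar> powr s \<le> m \<xi> \<and> m \<xi> \<le> A * \<bar>\<xi>\<bar> powr s"
    and small: "\<And>\<xi>. \<bar>\<xi>\<bar> \<le> 1 \<Longrightarrow> 0 \<le> m \<xi> \<and> m \<xi> \<le> A"
    and s: "s > 0"
    using assms unfolding assumptionA_def by blast
  have "\<bar>m \<xi>\<bar> \<le> A * weight s \<xi>" for \<xi>
  proof (cases "\<bar>\<xi>\<bar> \<le> 1")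
    case True
    then show ?thesis
      using small[OF True] A s mult_left_mono[OF weight_ge_1[of s \<xi>], of A] by linarith
  next
    case False
    have "\<bar>\<xi>\<bar> powr s = (\<bar>\<xi>\<bar> powr 2) powr (s / 2)" by (subst powr_powr) simp
    also have "\<bar>\<xi>\<bar> powr 2 = \<xi>\<^sup>2" using False by simp
    also have "(\<xi>\<^sup>2) powr (s / 2) \<le> weight s \<xi>"
      unfolding weight_def using s by (intro powr_mono2) auto
    finally have "A * \<bar>\<xi>\<bar> powr s \<le> A * weight s \<xi>" using A by simp
    moreover have "0 \<le> m \<xi>" using big[of \<xi>] False A by (smt (verit) mult_nonneg_nonneg powr_ge_zero)
    ultimately show ?thesis using big[of \<xi>] False by simp
  qed
  with A that show ?thesis by (metis less_imp_le)
qed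

text \<open>The square of \<open>f\<close> is again smooth and equals the constant
  \<open>c\<^sup>2\<close> outside the same interval, so the convergence theorem for cutoffs applies
  to both \<open>f\<close> and its square.\<close>

theorem commutator_form_tendsto:
  fixes f :: "real \<Rightarrow> real"
  assumes A: "assumptionA s m" and u: "sobolev (s / 2) u"
    and f: "smooth f" "\<And>x. \<bar>x\<bar> > R \<Longrightarrow> f x = c"
  shows "((\<lambda>r. pairing m (\<lambda>x. complex_of_real (f (x / r)) * u x) (\<lambda>x. complex_of_real (f (x / r)) * u x)
               - pairing m (\<lambda>x. complex_of_real ((f (x / r))\<^sup>2) * u x) u) \<longlongrightarrow> 0) at_top"
proof (rule tendsto_at_topI_sequentially)
  fix X :: "nat \<Rightarrow> real" assume X: "filterlim X at_top sequentially"
  define h where "h = (\<lambda>n. inverse (X n))"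
  have h: "h \<longlonglongrightarrow> 0"
    unfolding h_def using X by (rule tendsto_inverse_0_at_top)
  \<comment> \<open>Also valid where \<open>X n\<close> is 0, since division by 0 and
    \<open>inverse 0\<close> are both 0.\<close>
  have hx: "x / X n = h n * x" for x n by (simp add: h_def divide_inverse mult.commute)
  have s: "s \<ge> 0" and m_m: "m \<in> borel_measurable borel"
    using A piecewise_cont_measurable by (auto simp: assumptionA_def)
  obtain M where M: "M \<ge> 0" "\<And>\<xi>. \<bar>m \<xi>\<bar> \<le> M * weight s \<xi>"
    using assumptionA_bound[OF A] by blast
  obtain U where U: "fourier_L2 u U" and "integrable lborel (\<lambda>\<xi>. (1 + \<xi>\<^sup>2) powr (s / 2) * (cmod (U \<xi>))\<^sup>2)"
    using u unfolding sobolev_def by blast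
  then have fin: "wenergy s U < \<infinity>"
    by (auto simp: wenergy_def weight_def integrable_iff_bounded)
  have U_m[measurable]: "U \<in> borel_measurable borel"
    using U by (auto simp: fourier_L2_iff L2_iff)
  have fCk: "Ck k f" for k using f(1) by (rule smooth_imp_Ck)
  have f2Ck: "Ck k (\<lambda>x. (f x)\<^sup>2)" for k unfolding power2_eq_square by (intro Ck_mult fCk)
  define v where "v = (\<lambda>n x. complex_of_real (f (h n * x)) * u x)"
  define w where "w = (\<lambda>n x. complex_of_real ((f (h n * x))\<^sup>2) * u x)"
  have v: "fourier_L2 (v n) (fourier (v n))"
    "(\<lambda>n. wenergy s (\<lambda>\<xi>. fourier (v n) \<xi> - of_real (f 0) * U \<xi>)) \<longlonglongrightarrow> 0" for n
    unfolding v_def by (rule fourier_cutoff_tendsto[OF fCk f(2) U fin s h]; assumption)+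
  have w: "fourier_L2 (w n) (fourier (w n))"
    "(\<lambda>n. wenergy s (\<lambda>\<xi>. fourier (w n) \<xi> - of_real ((f 0)\<^sup>2) * U \<xi>)) \<longlonglongrightarrow> 0" for n
    unfolding w_def by (rule fourier_cutoff_tendsto[OF f2Ck _ U fin s h, of R "c\<^sup>2"]; simp add: f(2))+
  \<comment> \<open>\<open>fourier u\<close> and \<open>U\<close> may be different representatives;
    this lets the constant sequence \<open>fourier u\<close> count as converging to \<open>U\<close>
    in energy.\<close>
  have u0: "wenergy s (\<lambda>\<xi>. fourier u \<xi> - U \<xi>) = 0"
    using wenergy_fourier_diff[OF U, of s U] by (simp add: wenergy_def)
  have cfin: "wenergy s (\<lambda>\<xi>. z * U \<xi>) < \<infinity>" for z
    using fin by (simp add: wenergy_cmult ennreal_mult_less_top)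
  note meas = m_m U_m fourier_measurable[OF v(1)] fourier_measurable[OF w(1)] fourier_measurable[OF U]
  have 1: "(\<lambda>n. pairing m (v n) (v n)) \<longlonglongrightarrow> (\<integral>\<xi>. cnj (of_real (f 0) * U \<xi>) * of_real (m \<xi>) * (of_real (f 0) * U \<xi>) \<partial>lborel)"
    unfolding pairing_def
    by (rule multiplier_form_tendsto[OF _ _ _ _ _ M(2,1) cfin cfin v(2) v(2)]) (use meas in measurable)
  have 2: "(\<lambda>n. pairing m (w n) u) \<longlonglongrightarrow> (\<integral>\<xi>. cnj (of_real ((f 0)\<^sup>2) * U \<xi>) * of_real (m \<xi>) * U \<xi> \<partial>lborel)"
    unfolding pairing_def
    by (rule multiplier_form_tendsto[OF _ _ _ _ _ M(2,1) cfin fin w(2)]) (use meas u0 in \<open>auto\<close>)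
  \<comment> \<open>Since \<open>f 0\<close> is real, it passes through the conjugation, and both
    limits carry the factor \<open>(f 0)\<^sup>2\<close>.\<close>
  have "(\<integral>\<xi>. cnj (of_real (f 0) * U \<xi>) * of_real (m \<xi>) * (of_real (f 0) * U \<xi>) \<partial>lborel)
      = (\<integral>\<xi>. cnj (of_real ((f 0)\<^sup>2) * U \<xi>) * of_real (m \<xi>) * U \<xi> \<partial>lborel)"
    by (intro Bochner_Integration.integral_cong refl) (simp add: power2_eq_square)
  with tendsto_diff[OF 1 2]
  have "(\<lambda>n. pairing m (v n) (v n) - pairing m (w n) u) \<longlonglongrightarrow> 0" by simp
  then show "(\<lambda>n. pairing m (\<lambda>x. complex_of_real (f (x / X n)) * u x) (\<lambda>x. complex_of_real (f (x / X n)) * u x)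
               - pairing m (\<lambda>x. complex_of_real ((f (x / X n))\<^sup>2) * u x) u) \<longlonglongrightarrow> 0"
    by (simp only: v_def w_def hx)
qed

text \<open>The real factor in front of \<open>Lu\<close> is moved to the other argument of the
  duality, which is why the second term pairs the squared cutoff times \<open>u\<close> with
  \<open>u\<close>. The constants at infinity are 0 for \<phi> and 1 for \<psi>, both attained
  beyond radius 2.\<close>

theorem mainTheorem3:
  fixes s :: real and m :: "real \<Rightarrow> real" and u :: "real \<Rightarrow> complex"
    and \<phi> \<psi> :: "real \<Rightarrow> real"
  assumes A: "assumptionA s m"
    and u: "sobolev (s / 2) u"
    and phi_smooth: "smooth \<phi>" and phi_range: "\<forall>x. 0 \<le> \<phi> x \<and> \<phi> x \<le> 1"
    and phi_in: "\<forall>x. \<bar>x\<bar> < 1 \<longrightarrow> \<phi> x = 1" and phi_out: "\<forall>x. \<bar>x\<bar> > 2 \<longrightarrow> \<phi> x = 0"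
    and psi_smooth: "smooth \<psi>" and psi_range: "\<forall>x. 0 \<le> \<psi> x \<and> \<psi> x \<le> 1"
    and psi_in: "\<forall>x. \<bar>x\<bar> < 1 \<longrightarrow> \<psi> x = 0" and psi_out: "\<forall>x. \<bar>x\<bar> > 2 \<longrightarrow> \<psi> x = 1"
  shows "((\<lambda>r. pairing m (\<lambda>x. complex_of_real (\<phi> (x / r)) * u x) (\<lambda>x. complex_of_real (\<phi> (x / r)) * u x)
               - pairing m (\<lambda>x. complex_of_real ((\<phi> (x / r))\<^sup>2) * u x) u) \<longlongrightarrow> 0) at_top
       \<and> ((\<lambda>r. pairing m (\<lambda>x. complex_of_real (\<psi> (x / r)) * u x) (\<lambda>x. complex_of_real (\<psi> (x / r)) * u x)
               - pairing m (\<lambda>x. complex_of_real ((\<psi> (x / r))\<^sup>2) * u x) u) \<longlongrightarrow> 0) at_top"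
  using phi_out psi_out
  by (intro conjI commutator_form_tendsto[OF A u phi_smooth, of 2 0] commutator_form_tendsto[OF A u psi_smooth, of 2 1]) auto

end
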